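(* Let $F:\mathbb{R}^n\to\mathbb{R}^n$ be a function in $\mathrm{span}(\Phi_{\rm abs})$ (with a fixed evaluation procedure) and let $x^*$ be an isolated root of $F$ in an open neighborhood $\mathcal{D}$ of $x^*$. If the tangent mode piecewise linearization $\lozenge_{x^*}F$ is coherently oriented on $\mathcal{D}$, then there exists a radius $R>0$ such that: (i) for any initial point $x_0\in B(x^*,R)$ the tangent mode Newton iteration $x_{j+1}\in N(x_j)$ ($j\ge 0$) converges quadratically to $x^*$; and (ii) for any initial points $x_0,x_1\in B(x^*,R)$ the secant mode Newton iteration $x_{j+1}\in N(x_j,x_{j-1})$ ($j\ge1$) converges to $x^*$ with order $\frac{1+\sqrt5}{2}$.
   Context: Elemental functions and PCS functions: $\Phi$ is a library of elemental functions consisting of the binary arithmetic operations and unary functions (such as $\sin,\cos,\exp,\log,\dots$), each differentiable with (locally) Lipschitz continuous derivative on its open domain; $\Phi_{\rm abs}=\Phi\cup\{\mathrm{abs}\}$ with $\mathrm{abs}(x)=|x|$. A function $F$ belongs to $\mathrm{span}(\Phi_{\rm abs})$ (is piecewise composite smooth, PCS) if it is computed by an evaluation procedure: a finite sequence of intermediate values $v_i$, beginning with the components of $x$ and ending with the components of $F(x)$, in which each further $v_i$ is $v_j\pm v_k$, $v_j * v_k$, $\varphi_i(v_j)$ with $\varphi_i\in\Phi$ unary, or $\mathrm{abs}(v_j)$ for earlier values $v_j,v_k$ (division is written as multiplication by a reciprocal; constants are allowed). The procedure is assumed well defined near all reference points considered. Tangent mode piecewise linearization at $\mathring x$: let $\mathring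 v_i$ be the values of the procedure at $\mathring x$. Starting from $\Delta x=x-\mathring x$, set $\Delta v_i=\Delta v_j\pm\Delta v_k$ if $v_i=v_j\pm v_k$; $\Delta v_i=\mathring v_j\Delta v_k+\Delta v_j\mathring v_k$ if $v_i=v_j*v_k$; $\Delta v_i=\varphi_i'(\mathring v_j)\Delta v_j$ if $v_i=\varphi_i(v_j)$; $\Delta v_i=|\mathring v_j+\Delta v_j|-|\mathring v_j|$ if $v_i=|v_j|$. The resulting output increment is $\Delta F(\mathring x;\Delta x)$, and $\lozenge_{\mathring x}F(x)=F(\mathring x)+\Delta F(\mathring x;x-\mathring x)$. Secant mode piecewise linearization at $\check x,\hat x$: let $\check v_i,\hat v_i$ be the values of the procedure at $\check x$ and $\hat x$, $\mathring v_i=(\check v_i+\hat v_i)/2$, $\mathring x=(\check x+\hat x)/2$, and $\Delta x=x-\mathring x$. Use the same rules for $\pm$ and $*$; for $v_i=\varphi_i(v_j)$ set $\Delta v_i=\mathring c_{ij}\Delta v_j$ with $\mathring c_{ij}=\varphi_i'(\mathring v_j)$ if $\check v_j=\hat v_j$ and $\mathring c_{ij}=(\hat v_i-\check v_i)/(\hat v_j-\check v_j)$ otherwise; for $v_i=|v_j|$ set $\Delta v_i=|\mathring v_j+\Delta v_j|-\mathring v_i$, where $\mathring v_i=(|\check v_j|+|\hat v_j|)/2$. The output increment is $\Delta F(\check x,\hat x;\Delta x)$, and $\lozenge_{\check x}^{\hat x}F(x)=\tfrac12(F(\check x)+F(\hat x))+\Delta F(\check x,\hat x;x-\mathring x)$.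 Both linearizations are continuous piecewise linear functions of $x\in\mathbb{R}^n$. A continuous function $P:\mathbb{R}^n\to\mathbb{R}^n$ is piecewise linear if there are finitely many affine functions $P_i(x)=A_ix+b_i$ (selection functions) such that at every $x$ the function $P$ coincides with some $P_i$. It is coherently oriented on an open set $U$ if the linear parts $A_i$ of all selection functions that are active on (i.e. coincide with $P$ on) some nonempty open subset of $U$ have determinants of the same nonzero sign. Newton operator (set-valued): in tangent mode $N(\mathring x)=\arg\min\{\|x-\mathring x\|:\lozenge_{\mathring x}F(x)=0\}$; in secant mode $N(\check x,\hat x)=\arg\min\{\|x-\mathring x\|:\lozenge_{\check x}^{\hat x}F(x)=0\}$ with $\mathring x=\tfrac12(\check x+\hat x)$. The operator is defined at the given point(s) if the respective equation has at least one root; the convergence assertion includes that all Newton steps are defined, and it holds for every choice of the elements $x_{j+1}$. $x^*$ being an isolated root of $F$ in $\mathcal D$ means that $x^*\in\mathcal{D}$ is the only root of $F$ in $\mathcal{D}$. $B(x^*,R)$ is the open ball of radius $R$ about $x^*$. Quadratic convergence: $x_j\to x^*$ and there is a constant $C$ with $\|x_{j+1}-x^*\|\le C\|x_j-x^*\|^2$ for all $j$. Convergence with order $p=\frac{1+\sqrt5}2$ is understood as (R-)order at least $p$: there are $C>0$ and $q\in(0,1)$ with $\|x_j-x^*\|\le C q^{p^j}$ for all $j$. *)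

theory Defs
  imports "HOL-Analysis.Analysis"
begin

section \<open>Elemental functions and evaluation procedures\<close>

text \<open>A unary elemental function is given together with its open domain; the underlying HOL
  function is total, but its values off the domain are never relevant.\<close>

type_synonym elemental = "real set \<times> (real \<Rightarrow> real)"

definition elemental_library :: "elemental set \<Rightarrow> bool" where
  "elemental_library \<Phi> \<longleftrightarrow>
     (\<forall>(D, \<phi>) \<in> \<Phi>. open D \<and> \<phi> differentiable_on D \<and>
        (\<forall>t\<in>D. \<exists>u>0. \<exists>L. L-lipschitz_on (cball t u \<inter> D) (deriv \<phi>)))"

text \<open>The numbers are positions of operands in the list of values computed so far.\<close>

datatype instr =
    Const real
  | Add nat nat
  | Sub nat nat
  | Mul nat nat
  | Uni elemental nat
  | Abs nat

fun operands :: "instr \<Rightarrow> nat set" where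
  "operands (Const c) = {}"
| "operands (Add j k) = {j, k}"
| "operands (Sub j k) = {j, k}"
| "operands (Mul j k) = {j, k}"
| "operands (Uni u j) = {j}"
| "operands (Abs j) = {j}"

definition procedure :: "elemental set \<Rightarrow> nat \<Rightarrow> instr list \<Rightarrow> bool" where
  "procedure \<Phi> n p \<longleftrightarrow>
     (\<forall>i<length p. \<forall>j\<in>operands (p ! i). j < n + i) \<and>
     (\<forall>u j. Uni u j \<in> set p \<longrightarrow> u \<in> \<Phi>)"

text \<open>The instructions of \<open>p\<close> are executed in order, each appending one value.\<close>

definition run :: "(real list \<Rightarrow> instr \<Rightarrow> real) \<Rightarrow> instr list \<Rightarrow> real list \<Rightarrow> real list" where
  "run f p vs = foldl (\<lambda>us e. us @ [f us e]) vs p"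

text \<open>The components of a vector are listed in a fixed enumeration of the index type:
  \<open>to_nat_on UNIV\<close> is a bijection from \<open>'n\<close> onto \<open>{..<CARD('n)}\<close> with inverse
  \<open>from_nat_into UNIV\<close>. The inputs are the first and the outputs the last \<open>CARD('n)\<close> values.\<close>

definition coords :: "real^'n \<Rightarrow> real list" where
  "coords x = map (\<lambda>k. x $ from_nat_into UNIV k) [0..<CARD('n)]"

definition last_coords :: "real list \<Rightarrow> real^'n" where
  "last_coords vs = (\<chi> i. vs ! (length vs - CARD('n) + to_nat_on (UNIV :: 'n set) i))"

fun eval_instr :: "real list \<Rightarrow> instr \<Rightarrow> real" where
  "eval_instr vs (Const c) = c"
| "eval_instr vs (Add j k) = vs ! j + vs ! k"
| "eval_instr vs (Sub j k) = vs ! j - vs ! k"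
| "eval_instr vs (Mul j k) = vs ! j * vs ! k"
| "eval_instr vs (Uni u j) = snd u (vs ! j)"
| "eval_instr vs (Abs j) = \<bar>vs ! j\<bar>"

definition proc_values :: "instr list \<Rightarrow> real^'n \<Rightarrow> real list" where
  "proc_values p x = run eval_instr p (coords x)"

definition proc_fun :: "instr list \<Rightarrow> real^'n \<Rightarrow> real^'n" where
  "proc_fun p x = last_coords (proc_values p x)"

definition well_defined :: "instr list \<Rightarrow> real^'n \<Rightarrow> bool" where
  "well_defined p x \<longleftrightarrow> (\<forall>D \<phi> j. Uni (D, \<phi>) j \<in> set p \<longrightarrow> proc_values p x ! j \<in> D)"

text \<open>\<open>F\<close> belongs to the span of the library together with \<open>abs\<close>, with evaluation procedure
  \<open>p\<close>. The procedure may involve partial elementals, so it computes \<open>F\<close> where it is defined.\<close>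

definition computes :: "elemental set \<Rightarrow> instr list \<Rightarrow> (real^'n \<Rightarrow> real^'n) \<Rightarrow> bool" where
  "computes \<Phi> p F \<longleftrightarrow>
     procedure \<Phi> CARD('n) p \<and> (\<forall>x. well_defined p x \<longrightarrow> F x = proc_fun p x)"


section \<open>Piecewise linearization\<close>

text \<open>\<open>vs\<close> are the values at the reference point, \<open>ds\<close> the increments computed so far.\<close>

fun tangent_instr :: "real list \<Rightarrow> real list \<Rightarrow> instr \<Rightarrow> real" where
  "tangent_instr vs ds (Const c) = 0"
| "tangent_instr vs ds (Add j k) = ds ! j + ds ! k"
| "tangent_instr vs ds (Sub j k) = ds ! j - ds ! k"
| "tangent_instr vs ds (Mul j k) = vs ! j * ds ! k + ds ! j * vs ! k"
| "tangent_instr vs ds (Uni u j) = deriv (snd u) (vs ! j) * ds ! j"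
| "tangent_instr vs ds (Abs j) = \<bar>vs ! j + ds ! j\<bar> - \<bar>vs ! j\<bar>"

definition tangent_incr :: "instr list \<Rightarrow> real^'n \<Rightarrow> real^'n \<Rightarrow> real^'n" where
  "tangent_incr p x0 dx = last_coords (run (tangent_instr (proc_values p x0)) p (coords dx))"

definition tangent_lin :: "instr list \<Rightarrow> real^'n \<Rightarrow> real^'n \<Rightarrow> real^'n" where
  "tangent_lin p x0 x = proc_fun p x0 + tangent_incr p x0 (x - x0)"

text \<open>\<open>us\<close> and \<open>ws\<close> are the values at the two reference points.\<close>

definition avg :: "real list \<Rightarrow> real list \<Rightarrow> nat \<Rightarrow> real" where
  "avg us ws j = (us ! j + ws ! j) / 2"

fun secant_instr :: "real list \<Rightarrow> real list \<Rightarrow> real list \<Rightarrow> instr \<Rightarrow> real" where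
  "secant_instr us ws ds (Const c) = 0"
| "secant_instr us ws ds (Add j k) = ds ! j + ds ! k"
| "secant_instr us ws ds (Sub j k) = ds ! j - ds ! k"
| "secant_instr us ws ds (Mul j k) = avg us ws j * ds ! k + ds ! j * avg us ws k"
| "secant_instr us ws ds (Uni u j) =
     (if us ! j = ws ! j then deriv (snd u) (avg us ws j)
      else (snd u (ws ! j) - snd u (us ! j)) / (ws ! j - us ! j)) * ds ! j"
| "secant_instr us ws ds (Abs j) = \<bar>avg us ws j + ds ! j\<bar> - (\<bar>us ! j\<bar> + \<bar>ws ! j\<bar>) / 2"

definition secant_incr :: "instr list \<Rightarrow> real^'n \<Rightarrow> real^'n \<Rightarrow> real^'n \<Rightarrow> real^'n" where
  "secant_incr p a b dx =
     last_coords (run (secant_instr (proc_values p a) (proc_values p b)) p (coords dx))"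

definition secant_lin :: "instr list \<Rightarrow> real^'n \<Rightarrow> real^'n \<Rightarrow> real^'n \<Rightarrow> real^'n" where
  "secant_lin p a b x =
     (1/2) *\<^sub>R (proc_fun p a + proc_fun p b) + secant_incr p a b (x - midpoint a b)"


section \<open>Piecewise linear functions\<close>

definition selection_family ::
    "((real^'n^'n) \<times> (real^'n)) set \<Rightarrow> (real^'n \<Rightarrow> real^'n) \<Rightarrow> bool" where
  "selection_family S P \<longleftrightarrow> finite S \<and> (\<forall>x. \<exists>(A, b)\<in>S. P x = A *v x + b)"

definition active_on :: "(real^'n) set \<Rightarrow> (real^'n \<Rightarrow> real^'n) \<Rightarrow> real^'n^'n \<Rightarrow> real^'n \<Rightarrow> bool" where
  "active_on U P A b \<longleftrightarrow>
     (\<exists>V. open V \<and> V \<noteq> {} \<and> V \<subseteq> U \<and> (\<forall>x\<in>V. P x = A *v x + b))"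

text \<open>An affine map that is active on an open subset of \<open>U\<close> occurs in every selection family, so
  the choice of the family is irrelevant.\<close>

definition coherently_oriented_on :: "(real^'n) set \<Rightarrow> (real^'n \<Rightarrow> real^'n) \<Rightarrow> bool" where
  "coherently_oriented_on U P \<longleftrightarrow>
     continuous_on UNIV P \<and>
     (\<exists>S. selection_family S P \<and>
        (\<exists>\<sigma>\<in>{-1, 1}. \<forall>(A, b)\<in>S. active_on U P A b \<longrightarrow> sgn (det A) = \<sigma>))"


section \<open>Newton operators and orders of convergence\<close>

definition tangent_newton :: "instr list \<Rightarrow> real^'n \<Rightarrow> (real^'n) set" where
  "tangent_newton p x0 = {x. is_arg_min (\<lambda>x. norm (x - x0)) (\<lambda>x. tangent_lin p x0 x = 0) x}"

definition secant_newton :: "instr list \<Rightarrow> real^'n \<Rightarrow> real^'n \<Rightarrow> (real^'n) set" where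
  "secant_newton p a b =
     {x. is_arg_min (\<lambda>x. norm (x - midpoint a b)) (\<lambda>x. secant_lin p a b x = 0) x}"

definition tangent_newton_defined :: "instr list \<Rightarrow> real^'n \<Rightarrow> bool" where
  "tangent_newton_defined p x0 \<longleftrightarrow> well_defined p x0 \<and> (\<exists>x. tangent_lin p x0 x = 0)"

definition secant_newton_defined :: "instr list \<Rightarrow> real^'n \<Rightarrow> real^'n \<Rightarrow> bool" where
  "secant_newton_defined p a b \<longleftrightarrow>
     well_defined p a \<and> well_defined p b \<and> (\<exists>x. secant_lin p a b x = 0)"

definition converges_quadratically :: "(nat \<Rightarrow> real^'n) \<Rightarrow> real^'n \<Rightarrow> bool" where
  "converges_quadratically x l \<longleftrightarrow>
     x \<longlonglongrightarrow> l \<and> (\<exists>C. \<forall>j. norm (x (Suc j) - l) \<le> C * (norm (x j - l))\<^sup>2)"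

definition converges_with_R_order :: "real \<Rightarrow> (nat \<Rightarrow> real^'n) \<Rightarrow> real^'n \<Rightarrow> bool" where
  "converges_with_R_order r x l \<longleftrightarrow>
     x \<longlonglongrightarrow> l \<and> (\<exists>C>0. \<exists>q. 0 < q \<and> q < 1 \<and> (\<forall>j. norm (x j - l) \<le> C * q powr (r ^ j)))"


section \<open>Defined Newton steps exist\<close>

lemma continuous_on_run_nth:
  assumes len: "\<And>x. length (g x) = m"
    and cont: "\<And>j. continuous_on UNIV (\<lambda>x::real^'n. g x ! j)"
    and step: "\<And>h e. (\<And>j. continuous_on UNIV (\<lambda>x::real^'n. h x ! j)) \<Longrightarrow>
                 continuous_on UNIV (\<lambda>x. f (h x) e)"
  shows "length (run f p (g x)) = m + length p \<and>
         continuous_on UNIV (\<lambda>x. run f p (g x) ! j)"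
proof (induction p arbitrary: j x rule: rev_induct)
  case Nil
  then show ?case using len cont by (simp add: run_def)
next
  case (snoc e p)
  have run: "run f (p @ [e]) (g x) = run f p (g x) @ [f (run f p (g x)) e]" for x
    by (simp add: run_def)
  have "continuous_on UNIV (\<lambda>x. run f (p @ [e]) (g x) ! j)"
  proof (cases "j < m + length p")
    case True
    then show ?thesis using snoc by (simp add: run nth_append)
  next
    case False
    then show ?thesis using snoc step[of "\<lambda>x. run f p (g x)" e]
      by (cases "j - (m + length p)") (simp_all add: run nth_append)
  qed
  then show ?case using snoc run by simp
qed

lemma continuous_on_last_coords_run:
  fixes a :: "real^'n"
  assumes "\<And>(h :: real^'n \<Rightarrow> real list) e. (\<And>j. continuous_on UNIV (\<lambda>x. h x ! j)) \<Longrightarrow>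
             continuous_on UNIV (\<lambda>x. f (h x) e)"
  shows "continuous_on UNIV (\<lambda>x. last_coords (run f p (coords (x - a))) :: real^'n)"
proof -
  have "continuous_on UNIV (\<lambda>x::real^'n. coords (x - a) ! j)" for j
  proof (cases "j < CARD('n)")
    case True
    then show ?thesis by (auto simp: coords_def intro!: continuous_intros)
  next
    case False
    have out: "ys ! j = [] ! (j - length ys)" if "length ys \<le> j" for ys :: "real list"
      using nth_append_length_plus[of ys "[]" "j - length ys"] that by simp
    have "coords (x - a) ! j = [] ! (j - CARD('n))" for x :: "real^'n"
      using False out[of "coords (x - a)"] by (simp add: coords_def)
    then show ?thesis by simp
  qed
  note run = continuous_on_run_nth[where g = "\<lambda>x. coords (x - a)" and m = "CARD('n)" and f = f,
      OF _ this assms]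
  have "length (run f p (coords (x - a))) = CARD('n) + length p" for x :: "real^'n"
    using run by (simp add: coords_def)
  then show ?thesis
    unfolding last_coords_def using run by (auto simp: coords_def intro!: continuous_on_vec_lambda)
qed

lemma ex_is_arg_min_root:
  fixes G :: "real^'n \<Rightarrow> real^'n"
  assumes "continuous_on UNIV G" and "\<exists>x. G x = 0"
  shows "{x. is_arg_min (\<lambda>x. norm (x - c)) (\<lambda>x. G x = 0) x} \<noteq> {}"
proof -
  have "closed {x. G x = 0}"
    using assms(1) by (simp add: closed_Collect_eq)
  then obtain y where "y \<in> {x. G x = 0}" "\<And>z. z \<in> {x. G x = 0} \<Longrightarrow> dist c y \<le> dist c z"
    using distance_attains_inf[of "{x. G x = 0}" c] assms(2) by blast
  then show ?thesis
    by (force simp: is_arg_min_def dist_norm norm_minus_commute not_less)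
qed

lemma tangent_newton_nonempty:
  fixes x0 :: "real^'n"
  assumes "tangent_newton_defined p x0"
  shows "tangent_newton p x0 \<noteq> {}"
proof -
  have step: "continuous_on UNIV (\<lambda>x. tangent_instr vs (h x) e)"
    if "\<And>j. continuous_on UNIV (\<lambda>x::real^'n. h x ! j)" for vs e and h :: "real^'n \<Rightarrow> real list"
    using that by (cases e) (auto intro!: continuous_intros)
  have "continuous_on UNIV (tangent_lin p x0)"
    unfolding tangent_lin_def tangent_incr_def
    by (intro continuous_on_add continuous_on_const continuous_on_last_coords_run step)
  then show ?thesis
    using assms unfolding tangent_newton_defined_def tangent_newton_def
    by (intro ex_is_arg_min_root) auto
qed

lemma secant_newton_nonempty:
  fixes a b :: "real^'n"
  assumes "secant_newton_defined p a b"
  shows "secant_newton p a b \<noteq> {}"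
proof -
  have step: "continuous_on UNIV (\<lambda>x. secant_instr us ws (h x) e)"
    if "\<And>j. continuous_on UNIV (\<lambda>x::real^'n. h x ! j)" for us ws e and h :: "real^'n \<Rightarrow> real list"
    using that by (cases e) (auto intro!: continuous_intros)
  have "continuous_on UNIV (secant_lin p a b)"
    unfolding secant_lin_def secant_incr_def
    by (intro continuous_on_add continuous_on_const continuous_on_last_coords_run step)
  then show ?thesis
    using assms unfolding secant_newton_defined_def secant_newton_def
    by (intro ex_is_arg_min_root) auto
qed

end

theory Submission
  imports Defs "HOL-Computational_Algebra.Polynomial"
begin

text \<open>The linearization \<open>P\<close> of \<open>F\<close> at \<open>xs\<close> vanishes at \<open>xs\<close>, and coherent orientation makes its active
  pieces invertible, so \<open>c * norm (x - xs) \<le> norm (P x)\<close> near \<open>xs\<close>. A secant linearization at \<open>a\<close>, \<open>b\<close>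
  differs from \<open>F\<close> by at most \<open>\<gamma> * norm (x - a) * norm (x - b)\<close>; applied to the linearizations at
  \<open>(a, b)\<close> and at \<open>(xs, xs)\<close>, this shows that every zero \<open>x\<close> near \<open>xs\<close> of the former satisfies
  \<open>norm (x - xs) \<le> K * norm (a - xs) * norm (b - xs)\<close>. Tangent mode is the case \<open>a = b\<close>.

  The linearization at \<open>(a, b)\<close> need not be coherently oriented, so the existence of a zero is a degree
  argument: a continuous \<open>G\<close> closer to \<open>P\<close> than to 0 on a sphere has a zero inside. The degree is
  replaced by the integral of the Jacobian determinant, which for Lipschitz maps differentiable almost
  everywhere depends only on the boundary values: adding \<open>s\<close> times the identity turns both maps into
  homeomorphisms for large \<open>s\<close>, and the integral is a polynomial in \<open>s\<close>.\<close>

section \<open>Jacobian integrals of Lipschitz maps\<close>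

text \<open>Invertible pieces do not make \<open>P\<close> injective: a coherently oriented map of
  the plane can wrap twice around its zero, like z^2. Zeros of perturbations therefore cannot be
  expected from an inverse function or a contraction, only from a count with signs. The integral
  detects this count after both maps are composed with the nearest-point retraction onto a small
  ball about 0. The retracted \<open>P\<close> keeps determinants of one sign where \<open>P\<close>
  is small and has determinant 0 elsewhere, so its integral is not 0. A map whose norm exceeds the
  radius of the small ball is retracted into a sphere and has integral 0. Since \<open>G\<close> is
  merely continuous, a polynomial close to it is blended with \<open>P\<close> into a Lipschitz map
  that equals \<open>P\<close> on the sphere.

  A linearization may have further zeros far from \<open>xs\<close>. The minimal norm in the Newton
  operator controls the choice: the selected zero is no farther from the midpoint of the reference
  points than the zero found near \<open>xs\<close>.\<close>

lemma has_derivative_norm_le_lipschitz: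
  fixes f :: "'a::real_normed_vector \<Rightarrow> 'b::real_normed_vector"
  assumes "L-lipschitz_on UNIV f" "(f has_derivative f') (at x)"
  shows "norm (f' v) \<le> L * norm v"
proof (cases "v = 0")
  case True
  then show ?thesis
    using has_derivative_bounded_linear[OF assms(2)] by (simp add: linear_simps)
next
  case False
  interpret bounded_linear f' using assms(2) by (rule has_derivative_bounded_linear)
  have *: "norm (f' v) \<le> (L + e) * norm v" if "e > 0" for e
  proof -
    obtain d where d: "d > 0" "\<And>y. norm (y - x) < d \<Longrightarrow> norm (f y - f x - f' (y - x)) \<le> e * norm (y - x)"
      using assms(2) \<open>e > 0\<close> unfolding has_derivative_at_alt by blast
    define t where "t = d / (2 * norm v)"
    have t: "t > 0" "norm (t *\<^sub>R v) < d" using \<open>d > 0\<close> False by (auto simp: t_def)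
    have "norm (f' (t *\<^sub>R v)) \<le> norm (f (x + t *\<^sub>R v) - f x) + norm (f (x + t *\<^sub>R v) - f x - f' (t *\<^sub>R v))"
      by norm
    also have "\<dots> \<le> L * norm (t *\<^sub>R v) + e * norm (t *\<^sub>R v)"
      using d(2)[of "x + t *\<^sub>R v"] t lipschitz_onD[OF assms(1), of "x + t *\<^sub>R v" x]
      by (simp add: dist_norm)
    finally have "t * norm (f' v) \<le> t * ((L + e) * norm v)"
      using t by (simp add: scaleR algebra_simps)
    then show ?thesis using t by simp
  qed
  show ?thesis
  proof (rule field_le_epsilon)
    fix e :: real assume "e > 0"
    with *[of "e / norm v"] False show "norm (f' v) \<le> L * norm v + e"
      by (simp add: distrib_right)
  qed
qed

section \<open>Determinants of matrices shifted by a multiple of the identity\<close>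

lemma mat_mult_vec [simp]: "mat s *v v = s *\<^sub>R (v :: real^'n)"
  by (simp add: vec_eq_iff matrix_vector_mult_def mat_def if_distrib if_distribR cong: if_cong)

text \<open>A kernel vector of \<open>t *\<^sub>R A + mat s\<close> with 0 \<le> t \<le> 1 would
  satisfy s |v| = t |A v| \<le> L |v|. So no matrix on the segment from \<open>mat s\<close> to
  \<open>A + mat s\<close> is singular, and the determinant keeps its positive sign.\<close>

lemma det_add_mat_pos:
  fixes A :: "real^'n^'n"
  assumes A: "\<And>v. norm (A *v v) \<le> L * norm v" and s: "L < s" "0 < s"
  shows "0 < det (A + mat s)"
proof (rule ccontr)
  assume neg: "\<not> 0 < det (A + mat s)"
  define h where "h t = det (t *\<^sub>R A + mat s)" for t :: real
  have "continuous_on {0..1} h"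
    unfolding h_def det_def mat_def by (auto intro!: continuous_intros)
  moreover have "h 0 > 0" using s by (simp add: h_def det_diagonal mat_def)
  moreover have "h 1 \<le> 0" using neg by (simp add: h_def)
  ultimately obtain t where t: "0 \<le> t" "t \<le> 1" "h t = 0"
    using IVT2'[of h 1 0 0] by (auto simp: less_imp_le)
  then have "\<not> inj ((*v) (t *\<^sub>R A + mat s))"
    using det_nz_iff_inj[of "(*v) (t *\<^sub>R A + mat s)"] by (auto simp: h_def)
  then obtain v where v: "v \<noteq> 0" "(t *\<^sub>R A + mat s) *v v = 0"
    using linear_injective_0[of "(*v) (t *\<^sub>R A + mat s)"] by auto
  then have "s *\<^sub>R v = - (t *\<^sub>R (A *v v))"
    by (simp add: matrix_vector_mult_add_rdistrib scaleR_matrix_vector_assoc eq_neg_iff_add_eq_0 add.commute)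
  then have "s * norm v = t * norm (A *v v)" using s t
    by (metis abs_of_nonneg abs_of_pos norm_minus_cancel norm_scaleR)
  also have "\<dots> \<le> 1 * (L * norm v)" using t A[of v] by (intro mult_mono) auto
  finally show False using s v by simp
qed

text \<open>The condition is closed under sums and products, so it passes from matrix entries
  through the permutation expansion to the determinant. The uniform degree bound keeps the integral
  over x a polynomial in the parameter.\<close>

definition bounded_measurable_coeffs :: "'a::euclidean_space set \<Rightarrow> ('a \<Rightarrow> real poly) \<Rightarrow> bool" where
  "bounded_measurable_coeffs S h \<longleftrightarrow>
     (\<exists>d. \<forall>x\<in>S. degree (h x) \<le> d) \<and>
     (\<forall>k. (\<lambda>x. coeff (h x) k) \<in> borel_measurable (lebesgue_on S) \<and>
          bounded ((\<lambda>x. coeff (h x) k) ` S))"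

lemma bounded_measurable_coeffs_const: "bounded_measurable_coeffs S (\<lambda>_. c)"
  unfolding bounded_measurable_coeffs_def by (auto simp: image_constant_conv)

lemma bounded_measurable_coeffs_add:
  assumes "bounded_measurable_coeffs S f" "bounded_measurable_coeffs S g"
  shows "bounded_measurable_coeffs S (\<lambda>x. f x + g x)"
proof -
  obtain m n where mn: "\<forall>x\<in>S. degree (f x) \<le> m" "\<forall>x\<in>S. degree (g x) \<le> n"
    using assms unfolding bounded_measurable_coeffs_def by blast
  then have "\<forall>x\<in>S. degree (f x + g x) \<le> max m n"
    by (auto intro!: degree_add_le)
  with assms show ?thesis
    unfolding bounded_measurable_coeffs_def
    by (auto intro!: bounded_plus_comp borel_measurable_add)
qed

lemma bounded_mult_comp:
  fixes f g :: "'a \<Rightarrow> 'b::real_normed_algebra"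
  assumes "bounded (f ` S)" "bounded (g ` S)"
  shows "bounded ((\<lambda>x. f x * g x) ` S)"
proof -
  obtain M N where "\<forall>x\<in>S. norm (f x) \<le> M" "\<forall>x\<in>S. norm (g x) \<le> N"
    using assms by (auto simp: bounded_iff)
  then have "norm (f x * g x) \<le> M * N" if "x \<in> S" for x
    using that by (intro order_trans[OF norm_mult_ineq] mult_mono) (auto intro: order_trans[OF norm_ge_zero])
  then show ?thesis by (auto simp: bounded_iff)
qed

lemma bounded_sum_comp:
  fixes f :: "'i \<Rightarrow> 'a \<Rightarrow> 'b::real_normed_vector"
  assumes "finite I" "\<And>i. i \<in> I \<Longrightarrow> bounded (f i ` S)"
  shows "bounded ((\<lambda>x. \<Sum>i\<in>I. f i x) ` S)"
  using assms by (induction I) (auto intro!: bounded_plus_comp simp: image_constant_conv)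

lemma bounded_measurable_coeffs_mult:
  assumes "bounded_measurable_coeffs S f" "bounded_measurable_coeffs S g"
  shows "bounded_measurable_coeffs S (\<lambda>x. f x * g x)"
proof -
  obtain m n where mn: "\<forall>x\<in>S. degree (f x) \<le> m" "\<forall>x\<in>S. degree (g x) \<le> n"
    using assms unfolding bounded_measurable_coeffs_def by blast
  then have "\<forall>x\<in>S. degree (f x * g x) \<le> m + n"
    by (auto intro!: order_trans[OF degree_mult_le] add_mono)
  with assms show ?thesis
    unfolding bounded_measurable_coeffs_def coeff_mult
    by (auto intro!: bounded_sum_comp bounded_mult_comp borel_measurable_sum borel_measurable_times)
qed

lemma bounded_measurable_coeffs_sum:
  assumes "finite I" "\<And>i. i \<in> I \<Longrightarrow> bounded_measurable_coeffs S (f i)"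
  shows "bounded_measurable_coeffs S (\<lambda>x. \<Sum>i\<in>I. f i x)"
  using assms
  by (induction I) (auto intro!: bounded_measurable_coeffs_add bounded_measurable_coeffs_const)

lemma bounded_measurable_coeffs_prod:
  assumes "finite I" "\<And>i. i \<in> I \<Longrightarrow> bounded_measurable_coeffs S (f i)"
  shows "bounded_measurable_coeffs S (\<lambda>x. \<Prod>i\<in>I. f i x)"
  using assms
  by (induction I) (auto intro!: bounded_measurable_coeffs_mult bounded_measurable_coeffs_const)

text \<open>This is the characteristic polynomial of \<open>- A\<close>.\<close>

definition shifted_det_poly :: "real^'n^'n \<Rightarrow> real poly" where
  "shifted_det_poly A = det (\<chi> i j. [:A $ i $ j, if i = j then 1 else 0:])"

lemma poly_shifted_det_poly: "poly (shifted_det_poly A) s = det (A + mat s)"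
  by (auto simp: shifted_det_poly_def det_def poly_sum poly_prod mat_def of_int_poly
      intro!: sum.cong prod.cong)

lemma bounded_measurable_coeffs_shifted_det_poly:
  fixes A :: "real^'m::finite \<Rightarrow> real^'n^'n"
  assumes "\<And>i j. (\<lambda>x. A x $ i $ j) \<in> borel_measurable (lebesgue_on S)"
    and "\<And>i j. bounded ((\<lambda>x. A x $ i $ j) ` S)"
  shows "bounded_measurable_coeffs S (\<lambda>x. shifted_det_poly (A x))"
proof -
  have "bounded_measurable_coeffs S (\<lambda>x. [:A x $ i $ j, c:])" for i j c
    unfolding bounded_measurable_coeffs_def
  proof (intro conjI allI)
    fix k :: nat
    consider "k = 0" | "k = 1" | "(2::nat) \<le> k" by linarith
    then have "(\<lambda>x. coeff [:A x $ i $ j, c:] k) = (\<lambda>x. A x $ i $ j) \<or>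
               (\<exists>e. (\<lambda>x. coeff [:A x $ i $ j, c:] k) = (\<lambda>_. e))"
      by cases (auto simp: coeff_pCons fun_eq_iff split: nat.split)
    then show "(\<lambda>x. coeff [:A x $ i $ j, c:] k) \<in> borel_measurable (lebesgue_on S)"
      and "bounded ((\<lambda>x. coeff [:A x $ i $ j, c:] k) ` S)"
      using assms[of i j] by (elim disjE exE; simp only: image_constant_conv; simp)+
  qed (auto intro!: exI[of _ 1])
  then show ?thesis
    unfolding shifted_det_poly_def det_def
    by (auto intro!: bounded_measurable_coeffs_sum bounded_measurable_coeffs_mult
        bounded_measurable_coeffs_const bounded_measurable_coeffs_prod)
qed

text \<open>Integration is coefficientwise: bounded measurable coefficients are integrable on a set
  of finite measure.\<close>

lemma integral_poly_eq_poly: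
  assumes "S \<in> lmeasurable" "bounded_measurable_coeffs S h"
  obtains q where "\<And>s. integrable (lebesgue_on S) (\<lambda>x. poly (h x) s)"
    "\<And>s. (LINT x|lebesgue_on S. poly (h x) s) = poly q s"
proof -
  obtain d where d: "\<forall>x\<in>S. degree (h x) \<le> d"
    using assms unfolding bounded_measurable_coeffs_def by blast
  have int: "integrable (lebesgue_on S) (\<lambda>x. coeff (h x) k)" for k
  proof -
    obtain B where "\<forall>x\<in>S. norm (coeff (h x) k) \<le> B"
      using assms(2) unfolding bounded_measurable_coeffs_def bounded_iff by blast
    then show ?thesis
      using assms unfolding bounded_measurable_coeffs_def
      by (intro finite_measure.integrable_const_bound[where B=B])
         (auto simp: finite_measure_lebesgue_on intro!: AE_I2)
  qed
  have eq: "poly (h x) s = (\<Sum>k\<le>d. coeff (h x) k * s ^ k)" if "x \<in> S" for x s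
    unfolding poly_altdef using d that
    by (intro sum.mono_neutral_left) (auto simp: coeff_eq_0)
  show thesis
  proof
    show "integrable (lebesgue_on S) (\<lambda>x. poly (h x) s)" for s
      using int by (subst Bochner_Integration.integrable_cong[OF refl eq]) auto
    show "(LINT x|lebesgue_on S. poly (h x) s)
        = poly (\<Sum>k\<le>d. monom (LINT x|lebesgue_on S. coeff (h x) k) k) s" for s
      using int by (subst Bochner_Integration.integral_cong[OF refl eq]) (auto simp: poly_sum poly_monom)
  qed
qed

text \<open>The equation \<open>f x + s *\<^sub>R x = y\<close> says that x is fixed by the map
  sending x to (y - f x) / s, a contraction with factor L / s.\<close>

lemma add_scaleR_lipschitz_bij:
  fixes f :: "'a::{banach} \<Rightarrow> 'a"
  assumes L: "L-lipschitz_on UNIV f" and s: "L < s"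
  shows "bij (\<lambda>x. f x + s *\<^sub>R x)"
proof -
  have L0: "0 \<le> L" using L by (rule lipschitz_on_nonneg)
  have "\<exists>!x. f x + s *\<^sub>R x = y" for y
  proof -
    have "\<exists>!x. (1/s) *\<^sub>R (y - f x) = x"
    proof (rule banach_fix_type[of "L/s"])
      show "\<forall>x x'. dist ((1/s) *\<^sub>R (y - f x)) ((1/s) *\<^sub>R (y - f x')) \<le> L/s * dist x x'"
      proof (intro allI)
        fix x x'
        have "dist ((1/s) *\<^sub>R (y - f x)) ((1/s) *\<^sub>R (y - f x')) = dist (f x) (f x') / s"
          using s L0 by (simp add: dist_norm norm_minus_commute flip: scaleR_diff_right)
        then show "dist ((1/s) *\<^sub>R (y - f x)) ((1/s) *\<^sub>R (y - f x')) \<le> L/s * dist x x'"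
          using lipschitz_onD[OF L, of x x'] s L0 by (simp add: divide_right_mono)
      qed
    qed (use s L0 in auto)
    moreover have "(1/s) *\<^sub>R (y - f x) = x \<longleftrightarrow> f x + s *\<^sub>R x = y" for x
    proof -
      have "(1/s) *\<^sub>R (y - f x) = x \<longleftrightarrow> y - f x = s *\<^sub>R x"
        using s L0 by (metis divide_inverse_commute less_irrefl order_le_less_trans
            real_vector_affinity_eq scaleR_one scaleR_scaleR right_inverse mult.commute divide_inverse)
      then show ?thesis by (auto simp: algebra_simps)
    qed
    ultimately show ?thesis by simp
  qed
  then show ?thesis unfolding bij_iff by simp
qed

text \<open>For large s the two shifted maps are bijections that agree off \<open>B\<close>, hence
  carry \<open>B\<close> onto the same set. The measure of this set is the integral of the shifted
  determinant, which is positive there and so equals its absolute value. Two polynomials in s that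
  agree for all large s also agree at 0. The null set \<open>N\<close> has a null image because the
  maps are Lipschitz.\<close>

proposition integral_det_derivative_eq:
  fixes f g :: "real^'n::{finite,wellorder} \<Rightarrow> real^'n::_"
  assumes B: "B \<in> lmeasurable" and N: "negligible N"
    and f: "L-lipschitz_on UNIV f" "\<And>x. x \<in> B - N \<Longrightarrow> (f has_derivative f' x) (at x)"
    and g: "M-lipschitz_on UNIV g" "\<And>x. x \<in> B - N \<Longrightarrow> (g has_derivative g' x) (at x)"
    and eq: "\<And>x. x \<notin> B \<Longrightarrow> f x = g x"
  shows "integrable (lebesgue_on (B - N)) (\<lambda>x. det (matrix (f' x)))"
    and "(LINT x|lebesgue_on (B - N). det (matrix (f' x))) =
         (LINT x|lebesgue_on (B - N). det (matrix (g' x)))"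
proof -
  define S where "S = B - N"
  have S: "S \<in> lmeasurable"
    using B N unfolding S_def by (simp add: fmeasurable.Diff negligible_imp_measurable)
  have S': "S \<in> sets lebesgue" using S by blast
  \<comment> \<open>The same \<open>q\<close> is the integral for every s and, for s > K, the
    measure of the image of \<open>B\<close>. The second reading compares two maps, the first is
    evaluated at s = 0.\<close>
  have *: "\<exists>q. (\<forall>s. integrable (lebesgue_on S) (\<lambda>x. det (matrix (h' x) + mat s))) \<and>
      (\<forall>s. (LINT x|lebesgue_on S. det (matrix (h' x) + mat s)) = poly q s) \<and>
      (\<forall>s>K. measure lebesgue ((\<lambda>x. h x + s *\<^sub>R x) ` B) = poly q s)"
    if h: "K-lipschitz_on UNIV h" "\<And>x. x \<in> S \<Longrightarrow> (h has_derivative h' x) (at x)"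
    for K and h :: "real^'n::_ \<Rightarrow> real^'n::_" and h'
  proof -
    have K0: "0 \<le> K" using h(1) by (rule lipschitz_on_nonneg)
    have nrm: "norm (matrix (h' x) *v v) \<le> K * norm v" if "x \<in> S" for x v
      using has_derivative_norm_le_lipschitz[OF h(1) h(2)[OF that]] h(2)[OF that]
      by (simp add: has_derivative_linear)
    have "norm (matrix (h' x) $ i $ j) \<le> K" if "x \<in> S" for x i j
    proof -
      have "matrix (h' x) $ i $ j = (matrix (h' x) *v axis j 1) $ i"
        by (simp add: matrix_vector_mult_basis column_def)
      also have "norm \<dots> \<le> norm (matrix (h' x) *v axis j 1)"
        by (simp add: component_le_norm_cart)
      also have "\<dots> \<le> K" using nrm[OF that, of "axis j 1"] by simp
      finally show ?thesis .
    qed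
    then have "bounded_measurable_coeffs S (\<lambda>x. shifted_det_poly (matrix (h' x)))"
      by (intro bounded_measurable_coeffs_shifted_det_poly borel_measurable_partial_derivatives[OF S'])
         (auto intro: has_derivative_at_withinI h(2) simp: bounded_iff)
    then obtain q where q: "\<And>s. integrable (lebesgue_on S) (\<lambda>x. det (matrix (h' x) + mat s))"
      "\<And>s. (LINT x|lebesgue_on S. det (matrix (h' x) + mat s)) = poly q s"
      using integral_poly_eq_poly[OF S] by (metis (no_types, lifting) poly_shifted_det_poly Bochner_Integration.integrable_cong Bochner_Integration.integral_cong)
    have "measure lebesgue ((\<lambda>x. h x + s *\<^sub>R x) ` B) = poly q s" if "s > K" for s
    proof -
      let ?H = "\<lambda>x. h x + s *\<^sub>R x"
      have lips: "(K + s)-lipschitz_on UNIV ?H"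
        using that K0 by (intro lipschitz_on_add h(1) lipschitz_onI)
          (auto simp: dist_norm simp flip: scaleR_diff_right)
      have neg: "negligible (?H ` (B \<inter> N))"
      proof (rule negligible_locally_Lipschitz_image)
        show "\<exists>T C. open T \<and> x \<in> T \<and> (\<forall>y\<in>B \<inter> N \<inter> T. norm (?H y - ?H x) \<le> C * norm (y - x))" for x
          using lipschitz_onD[OF lips] by (auto simp: dist_norm intro!: exI[of _ UNIV] exI[of _ "K+s"])
      qed (use N in \<open>auto intro: negligible_subset\<close>)
      have der: "(?H has_derivative (\<lambda>v. h' x v + s *\<^sub>R v)) (at x within S)" if "x \<in> S" for x
        by (intro has_derivative_add has_derivative_scaleR_right has_derivative_ident
            has_derivative_at_withinI[OF h(2)[OF that]])
      have mat: "matrix (\<lambda>v. h' x v + s *\<^sub>R v) = matrix (h' x) + mat s" for x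
        by (simp add: matrix_def mat_def vec_eq_iff axis_def)
      have pos: "\<bar>det (matrix (\<lambda>v. h' x v + s *\<^sub>R v))\<bar> = det (matrix (h' x) + mat s)" if "x \<in> S" for x
        using det_add_mat_pos[OF nrm[OF that], of s] \<open>s > K\<close> K0 by (simp add: mat)
      have inj: "inj ?H" using bij_is_inj[OF add_scaleR_lipschitz_bij[OF h(1) \<open>s > K\<close>]] .
      have "((\<lambda>x. det (matrix (h' x) + mat s)) has_integral poly q s) S"
        using has_integral_integral_lebesgue_on[OF q(1) S'] q(2) by metis
      then have "((\<lambda>x. \<bar>det (matrix (\<lambda>v. h' x v + s *\<^sub>R v))\<bar>) has_integral poly q s) S"
        by (rule has_integral_eq[rotated]) (simp add: pos)
      then have "?H ` S \<in> lmeasurable \<and> measure lebesgue (?H ` S) = poly q s"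
        using has_measure_differentiable_image[OF S' der inj_on_subset[OF inj subset_UNIV]] by simp
      moreover have "?H ` B = ?H ` S \<union> ?H ` (B \<inter> N)" by (auto simp: S_def)
      ultimately show ?thesis
        using neg by (simp add: measure_Un_null_set negligible_iff_null_sets fmeasurableD)
    qed
    with q show ?thesis by blast
  qed
  obtain qf where qf: "\<And>s. integrable (lebesgue_on S) (\<lambda>x. det (matrix (f' x) + mat s))"
    "\<And>s. (LINT x|lebesgue_on S. det (matrix (f' x) + mat s)) = poly qf s"
    "\<And>s. s > L \<Longrightarrow> measure lebesgue ((\<lambda>x. f x + s *\<^sub>R x) ` B) = poly qf s"
    using *[of L f f'] f by (auto simp: S_def)
  obtain qg where qg: "\<And>s. (LINT x|lebesgue_on S. det (matrix (g' x) + mat s)) = poly qg s"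
    "\<And>s. s > M \<Longrightarrow> measure lebesgue ((\<lambda>x. g x + s *\<^sub>R x) ` B) = poly qg s"
    using *[of M g g'] g by (auto simp: S_def)
  have "poly (qf - qg) s = 0" if s: "s > max L M" for s
  proof -
    let ?F = "\<lambda>x. f x + s *\<^sub>R x" and ?G = "\<lambda>x. g x + s *\<^sub>R x"
    have bij: "bij ?F" "bij ?G"
      using s f(1) g(1) by (auto intro: add_scaleR_lipschitz_bij)
    have "?F ` (- B) = ?G ` (- B)" using eq by (intro image_cong) auto
    then have "?F ` B = ?G ` B"
      using bij by (metis bij_image_Compl_eq double_complement)
    then show ?thesis using qf(3)[of s] qg(2)[of s] s by simp
  qed
  then have "infinite {s. poly (qf - qg) s = 0}"
    by (intro infinite_super[OF _ infinite_Ioi[of "max L M"]]) auto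
  then have "qf = qg"
    using poly_roots_finite[of "qf - qg"] by auto
  then show "(LINT x|lebesgue_on (B - N). det (matrix (f' x))) =
      (LINT x|lebesgue_on (B - N). det (matrix (g' x)))"
    using qf(2)[of 0] qg(1)[of 0] by (simp add: S_def mat_0)
  show "integrable (lebesgue_on (B - N)) (\<lambda>x. det (matrix (f' x)))"
    using qf(1)[of 0] by (simp add: S_def mat_0)
qed

section \<open>Piecewise linear maps\<close>

text \<open>If the linear parts differ in some row, equality of that component confines x to a
  hyperplane. If they agree, the constants differ and the set is empty.\<close>

lemma negligible_affine_coincidence:
  fixes A A' :: "real^'n^'m"
  assumes "(A, b) \<noteq> (A', b')"
  shows "negligible {x. A *v x + b = A' *v x + b'}"
proof (cases "A = A'")
  case True
  then show ?thesis using assms by auto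
next
  case False
  then obtain i where i: "A $ i \<noteq> A' $ i" by (auto simp: vec_eq_iff[of A])
  have "{x. A *v x + b = A' *v x + b'} \<subseteq> {x. (A $ i - A' $ i) \<bullet> x = b' $ i - b $ i}"
  proof clarify
    fix x assume "A *v x + b = A' *v x + b'"
    then have "(A *v x + b) $ i = (A' *v x + b') $ i" by simp
    then show "(A $ i - A' $ i) \<bullet> x = b' $ i - b $ i"
      by (simp add: matrix_vector_mul_component inner_diff_left)
  qed
  then show ?thesis
    using i by (intro negligible_subset[OF negligible_hyperplane]) auto
qed

lemma closed_Collect_affine_eq:
  fixes A :: "real^'n^'m"
  assumes "continuous_on UNIV P"
  shows "closed {x. P x = A *v x + b}"
  using assms by (intro closed_Collect_eq continuous_intros) 
    (auto intro: matrix_vector_mult_linear_continuous_on)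

text \<open>Let \<open>N\<close> be the set where two distinct selection functions agree. Off
  \<open>N\<close> exactly one of them has the value of \<open>P\<close> at x. The coincidence sets
  of the others are closed and miss x, so \<open>P\<close> must follow the remaining one on a
  neighbourhood.\<close>

lemma selection_family_locally_affine:
  assumes S: "selection_family S P" and P: "continuous_on UNIV P"
  obtains N where "negligible N"
    "\<And>x. x \<notin> N \<Longrightarrow> \<exists>(A, b)\<in>S. \<exists>V. open V \<and> x \<in> V \<and> (\<forall>y\<in>V. P y = A *v y + b)"
proof
  define N where "N = (\<Union>(s, s')\<in>{(s, s'). s \<in> S \<and> s' \<in> S \<and> s \<noteq> s'}.
    {x. fst s *v x + snd s = fst s' *v x + snd s'})"
  have fin: "finite S" and cover: "\<And>x. \<exists>(A, b)\<in>S. P x = A *v x + b"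
    using S by (auto simp: selection_family_def)
  have "finite {(s, s'). s \<in> S \<and> s' \<in> S \<and> s \<noteq> s'}"
    by (rule finite_subset[of _ "S \<times> S"]) (use fin in auto)
  then show "negligible N" unfolding N_def
    by (intro negligible_Union finite_imageI) (auto intro!: negligible_affine_coincidence)
  fix x assume x: "x \<notin> N"
  obtain A b where Ab: "(A, b) \<in> S" "P x = A *v x + b" using cover by blast
  define V where "V = (\<Inter>s\<in>S - {(A, b)}. - {y. P y = fst s *v y + snd s})"
  have "open V" unfolding V_def
    using fin by (intro open_INT) (auto intro!: closed_Collect_affine_eq P simp: open_Compl)
  moreover have "x \<in> V"
  proof -
    have "P x \<noteq> fst s *v x + snd s" if "s \<in> S - {(A, b)}" for s
    proof
      assume "P x = fst s *v x + snd s"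
      then have "x \<in> N" unfolding N_def using Ab that by (intro UN_I[of "(s, (A, b))"]) auto
      with x show False by simp
    qed
    then show ?thesis by (simp add: V_def)
  qed
  moreover have "P y = A *v y + b" if "y \<in> V" for y
    using cover[of y] that unfolding V_def by force
  ultimately show "\<exists>(A, b)\<in>S. \<exists>V. open V \<and> x \<in> V \<and> (\<forall>y\<in>V. P y = A *v y + b)"
    using Ab by blast
qed

text \<open>The coincidence sets of the active pieces have a closed union. If it missed a point of
  \<open>U\<close>, the rest of \<open>U\<close> would be open and nonempty, hence contain a point
  near which \<open>P\<close> is affine, and the piece found there would be active.\<close>

lemma selection_family_active:
  assumes S: "selection_family S P" and P: "continuous_on UNIV P" and U: "open U" "x \<in> U"
  shows "\<exists>(A, b)\<in>S. active_on U P A b \<and> P x = A *v x + b"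
proof (rule ccontr)
  assume not: "\<not> ?thesis"
  obtain N where N: "negligible N"
    "\<And>x. x \<notin> N \<Longrightarrow> \<exists>(A, b)\<in>S. \<exists>V. open V \<and> x \<in> V \<and> (\<forall>y\<in>V. P y = A *v y + b)"
    using selection_family_locally_affine[OF S P] by blast
  define K where "K = (\<Union>s\<in>{s\<in>S. active_on U P (fst s) (snd s)}. {y. P y = fst s *v y + snd s})"
  have "closed K" unfolding K_def
    using S by (intro closed_UN) (auto simp: selection_family_def intro!: closed_Collect_affine_eq P)
  with U have "open (U - K)" by (rule_tac open_Diff)
  moreover have "x \<in> U - K" using not U by (auto simp: K_def)
  ultimately have "\<not> negligible (U - K)" using open_not_negligible by blast
  then obtain y where y: "y \<in> U" "y \<notin> K" "y \<notin> N"
    using N(1) negligible_subset[of N "U - K"] by blast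
  then obtain A b V where V: "(A, b) \<in> S" "open V" "y \<in> V" "\<forall>y\<in>V. P y = A *v y + b"
    using N(2) by blast
  then have "active_on U P A b"
    using U y unfolding active_on_def by (intro exI[of _ "U \<inter> V"]) auto
  with V y show False by (auto simp: K_def)
qed

text \<open>Along a segment the coincidence sets of the pieces are closed and cover the parameter
  interval. On each of them \<open>P\<close> is Lipschitz with a common constant, and such bounds
  join along an interval.\<close>

lemma selection_family_lipschitz:
  assumes S: "selection_family S P" and P: "continuous_on UNIV P"
  obtains L where "L-lipschitz_on UNIV P"
proof
  define L where "L = (\<Sum>s\<in>S. onorm ((*v) (fst s)))"
  have fin: "finite S" and cover: "\<And>x. \<exists>(A, b)\<in>S. P x = A *v x + b"
    using S by (auto simp: selection_family_def)
  have pos: "0 \<le> onorm ((*v) (fst s))" for s :: "(real^'a^'a) \<times> (real^'a)"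
    by (intro onorm_pos_le matrix_vector_mul_bounded_linear)
  then have L0: "0 \<le> L" unfolding L_def by (intro sum_nonneg)
  have lip: "norm (fst s *v v) \<le> L * norm v" if "s \<in> S" for s v
  proof -
    have "norm (fst s *v v) \<le> onorm ((*v) (fst s)) * norm v"
      by (intro onorm matrix_vector_mul_bounded_linear)
    also have "\<dots> \<le> L * norm v"
      unfolding L_def using fin that pos by (intro mult_right_mono member_le_sum) auto
    finally show ?thesis .
  qed
  show "L-lipschitz_on UNIV P"
  proof (rule lipschitz_onI)
    fix x y :: "real^'a"
    define l where "l t = x + t *\<^sub>R (y - x)" for t :: real
    have l: "continuous_on UNIV l" unfolding l_def by (intro continuous_intros)
    have "(L * norm (y - x))-lipschitz_on {0..1} (\<lambda>t. P (l t))"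
    proof (rule lipschitz_on_closed_Union)
      show "finite S" by fact
      show "{0..1} \<subseteq> (\<Union>s\<in>S. {t. P (l t) = fst s *v l t + snd s})"
        using cover by force
      show "0 \<le> L * norm (y - x)" using L0 by simp
      fix s assume s: "s \<in> S"
      show "closed {t. P (l t) = fst s *v l t + snd s}"
        using closed_vimage[OF closed_Collect_affine_eq[OF P, of "fst s" "snd s"] l] by simp
      show "(L * norm (y - x))-lipschitz_on {t. P (l t) = fst s *v l t + snd s} (\<lambda>t. P (l t))"
      proof (rule lipschitz_onI)
        fix t u assume "t \<in> {t. P (l t) = fst s *v l t + snd s}" "u \<in> {t. P (l t) = fst s *v l t + snd s}"
        then have "dist (P (l t)) (P (l u)) = norm (fst s *v (l t - l u))"
          by (simp add: dist_norm matrix_vector_mult_diff_distrib)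
        also have "\<dots> \<le> L * norm (l t - l u)" by (rule lip[OF s])
        also have "l t - l u = (t - u) *\<^sub>R (y - x)" by (simp add: l_def algebra_simps)
        finally show "dist (P (l t)) (P (l u)) \<le> L * norm (y - x) * dist t u"
          by (simp add: dist_norm mult.commute mult.left_commute)
      qed (use L0 in simp)
    qed
    from lipschitz_onD[OF this, of 0 1] show "dist (P x) (P y) \<le> L * dist x y"
      by (simp add: l_def dist_norm norm_minus_commute)
  qed (rule L0)
qed

text \<open>A small ball avoids all pieces that differ from \<open>P\<close> at \<open>x\<close>.
  Every remaining active piece reads \<open>A *v (y - x)\<close> with \<open>A\<close> invertible,
  and finitely many invertible matrices are bounded below by a common constant.\<close>

lemma coherently_oriented_lower_bound:
  assumes co: "coherently_oriented_on U P" and U: "open U" "x \<in> U" and x: "P x = 0"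
  obtains c r where "c > 0" "r > 0" "\<And>y. y \<in> cball x r \<Longrightarrow> c * norm (y - x) \<le> norm (P y)"
proof -
  obtain S \<sigma> where S: "selection_family S P" and P: "continuous_on UNIV P"
    and \<sigma>: "\<sigma> \<in> {-1, 1}" "\<forall>(A, b)\<in>S. active_on U P A b \<longrightarrow> sgn (det A) = \<sigma>"
    using co unfolding coherently_oriented_on_def by blast
  have fin: "finite S" using S by (simp add: selection_family_def)
  define T where "T = {s\<in>S. det (fst s) \<noteq> 0}"
  have finT: "finite T" using fin by (simp add: T_def)
  define W where "W = U \<inter> (\<Inter>s\<in>{s\<in>S. P x \<noteq> fst s *v x + snd s}. - {y. P y = fst s *v y + snd s})"
  have "open W" unfolding W_def
    using fin U by (intro open_Int open_INT ballI) (auto intro!: closed_Collect_affine_eq P simp: open_Compl)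
  moreover have "x \<in> W" using U by (auto simp: W_def)
  ultimately obtain r where r: "r > 0" "cball x r \<subseteq> W" using open_contains_cball by blast
  have "\<exists>c>0. \<forall>s\<in>T. \<forall>v. c * norm v \<le> norm (fst s *v v)"
    using finT
  proof (rule finite_induct[where P = "\<lambda>T. T \<subseteq> S \<inter> {s. det (fst s) \<noteq> 0} \<longrightarrow> (\<exists>c>0. \<forall>s\<in>T. \<forall>v. c * norm v \<le> norm (fst s *v v))", rule_format])
    show "T \<subseteq> S \<inter> {s. det (fst s) \<noteq> 0}" by (auto simp: T_def)
    show "\<exists>c>0. \<forall>s\<in>{}. \<forall>v. c * norm v \<le> norm (fst s *v v)" by (intro exI[of _ 1]) auto
  next
    fix s F assume "finite F" "s \<notin> F" and IH: "F \<subseteq> S \<inter> {s. det (fst s) \<noteq> 0} \<Longrightarrow> \<exists>c>0. \<forall>s\<in>F. \<forall>v. c * norm v \<le> norm (fst s *v v)"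
      and sub: "insert s F \<subseteq> S \<inter> {s. det (fst s) \<noteq> 0}"
    then obtain c where c: "c > 0" "\<forall>s\<in>F. \<forall>v. c * norm v \<le> norm (fst s *v v)" by auto
    have "inj ((*v) (fst s))" using sub det_nz_iff_inj[of "(*v) (fst s)"] by simp
    then obtain B where B: "B > 0" "\<And>v. norm v * B \<le> norm (fst s *v v)"
      using linear_inj_bounded_below_pos[of "(*v) (fst s)"] by (auto simp: mult.commute)
    show "\<exists>c>0. \<forall>s\<in>insert s F. \<forall>v. c * norm v \<le> norm (fst s *v v)"
    proof (intro exI[of _ "min c B"] conjI ballI allI)
      fix t v assume "t \<in> insert s F"
      then have "c * norm v \<le> norm (fst t *v v) \<or> B * norm v \<le> norm (fst t *v v)"
        using c(2) B(2)[of v] by (auto simp: mult.commute)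
      moreover have "min c B * norm v \<le> c * norm v" "min c B * norm v \<le> B * norm v"
        by (auto intro: mult_right_mono)
      ultimately show "min c B * norm v \<le> norm (fst t *v v)" by linarith
    qed (use c B in auto)
  qed
  then obtain c where c: "c > 0" "\<And>s v. s \<in> T \<Longrightarrow> c * norm v \<le> norm (fst s *v v)" by blast
  have "c * norm (y - x) \<le> norm (P y)" if "y \<in> cball x r" for y
  proof -
    have y: "y \<in> W" using that r by blast
    then obtain A b where Ab: "(A, b) \<in> S" "active_on U P A b" "P y = A *v y + b"
      using selection_family_active[OF S P U(1), of y] by (auto simp: W_def)
    have "P x = A *v x + b"
    proof (rule ccontr)
      assume "P x \<noteq> A *v x + b"
      with Ab(1) have "(A, b) \<in> {s \<in> S. P x \<noteq> fst s *v x + snd s}" by simp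
      with y have "P y \<noteq> A *v y + b" unfolding W_def by auto
      with Ab(3) show False by simp
    qed
    then have "P y = A *v (y - x)" using x Ab(3) by (simp add: matrix_vector_mult_diff_distrib algebra_simps)
    moreover have "sgn (det A) = \<sigma>" using Ab \<sigma>(2) by auto
    then have "(A, b) \<in> T" using Ab(1) \<sigma>(1) by (auto simp: T_def)
    ultimately show ?thesis using c(2)[of "(A, b)" "y - x"] by simp
  qed
  with that c r show thesis by blast
qed

section \<open>Zeros of perturbed coherently oriented maps\<close>

lemma lipschitz_on_scaleR_bounded:
  fixes f :: "'a::heine_borel \<Rightarrow> real" and g :: "'a \<Rightarrow> 'b::{heine_borel,real_normed_vector}"
  assumes "\<exists>L. L-lipschitz_on S f" "\<exists>M. M-lipschitz_on S g" "bounded S"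
  shows "\<exists>K. K-lipschitz_on S (\<lambda>x. f x *\<^sub>R g x)"
proof -
  obtain L M where L: "L-lipschitz_on S f" and M: "M-lipschitz_on S g" using assms by blast
  have "bounded (f ` S)" "bounded (g ` S)"
    using bounded_uniformly_continuous_image[OF lipschitz_on_uniformly_continuous[OF L] \<open>bounded S\<close>]
      bounded_uniformly_continuous_image[OF lipschitz_on_uniformly_continuous[OF M] \<open>bounded S\<close>]
    by auto
  then obtain a b where a: "\<And>x. x \<in> S \<Longrightarrow> norm (f x) \<le> a" and b: "\<And>x. x \<in> S \<Longrightarrow> norm (g x) \<le> b"
    by (auto simp: bounded_iff)
  have "(\<bar>a\<bar> * M + L * \<bar>b\<bar>)-lipschitz_on S (\<lambda>x. f x *\<^sub>R g x)"
  proof (rule lipschitz_onI)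
    fix x y assume xy: "x \<in> S" "y \<in> S"
    have "f x *\<^sub>R g x - f y *\<^sub>R g y = f x *\<^sub>R (g x - g y) + (f x - f y) *\<^sub>R g y"
      by (simp add: algebra_simps)
    then have "norm (f x *\<^sub>R g x - f y *\<^sub>R g y) \<le> \<bar>f x\<bar> * norm (g x - g y) + \<bar>f x - f y\<bar> * norm (g y)"
      by (metis norm_scaleR norm_triangle_ineq)
    also have "\<dots> \<le> \<bar>a\<bar> * (M * dist x y) + (L * dist x y) * \<bar>b\<bar>"
      using a[OF xy(1)] b[OF xy(2)] lipschitz_onD[OF L xy] lipschitz_onD[OF M xy]
      by (intro add_mono mult_mono) (auto simp: dist_norm intro: order_trans[OF abs_ge_zero])
    finally show "dist (f x *\<^sub>R g x) (f y *\<^sub>R g y) \<le> (\<bar>a\<bar> * M + L * \<bar>b\<bar>) * dist x y"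
      by (simp add: dist_norm algebra_simps)
  qed (use lipschitz_on_nonneg[OF L] lipschitz_on_nonneg[OF M] in auto)
  then show ?thesis ..
qed

lemma lipschitz_on_real_polynomial_function:
  fixes f :: "'a::euclidean_space \<Rightarrow> real"
  assumes "real_polynomial_function f" "bounded S"
  shows "\<exists>L. L-lipschitz_on S f"
  using assms(1)
proof induction
  case (linear f)
  then show ?case by (metis bounded_linear.lipschitz_boundE)
next
  case (const c)
  then show ?case using lipschitz_on_constant by blast
next
  case (add f g)
  then show ?case using lipschitz_on_add by blast
next
  case (mult f g)
  then show ?case using lipschitz_on_scaleR_bounded[of S f g] \<open>bounded S\<close> by simp
qed

lemma lipschitz_on_polynomial_function:
  fixes f :: "'a::euclidean_space \<Rightarrow> 'b::euclidean_space"
  assumes "polynomial_function f" "bounded S"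
  shows "\<exists>L. L-lipschitz_on S f"
proof -
  have "\<exists>L. L-lipschitz_on S (\<lambda>x. \<Sum>b\<in>I. (f x \<bullet> b) *\<^sub>R b)" if "finite I" "I \<subseteq> Basis" for I
    using that
  proof induction
    case empty
    then show ?case using lipschitz_on_constant by auto
  next
    case (insert b I)
    have "\<exists>L. L-lipschitz_on S (\<lambda>x. f x \<bullet> b)"
      using assms insert.prems
      by (intro lipschitz_on_real_polynomial_function) (auto simp: polynomial_function_iff_Basis_inner)
    then have "\<exists>L. L-lipschitz_on S (\<lambda>x. (f x \<bullet> b) *\<^sub>R b)"
      using \<open>bounded S\<close> lipschitz_on_constant by (intro lipschitz_on_scaleR_bounded) blast+
    then show ?case using insert lipschitz_on_add by (simp; blast)
  qed
  from this[of Basis] show ?thesis by (simp add: euclidean_representation)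
qed

text \<open>A segment that leaves the ball meets the sphere at a point z where both maps agree, and
  the distances to z add up along the segment.\<close>

lemma lipschitz_on_if_cball:
  fixes f g :: "'a::euclidean_space \<Rightarrow> 'b::metric_space"
  assumes f: "L-lipschitz_on (cball c r) f" and g: "M-lipschitz_on UNIV g"
    and eq: "\<And>x. x \<in> sphere c r \<Longrightarrow> f x = g x"
  shows "(max L M)-lipschitz_on UNIV (\<lambda>x. if x \<in> cball c r then f x else g x)"
    (is "_-lipschitz_on UNIV ?h")
proof -
  have *: "dist (?h x) (?h y) \<le> max L M * dist x y" if x: "x \<in> cball c r" and y: "y \<notin> cball c r" for x y
  proof -
    have "closed_segment x y \<inter> sphere c r \<noteq> {}"
    proof -
      have "closed_segment x y \<inter> cball c r \<noteq> {}" "closed_segment x y - cball c r \<noteq> {}"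
        using x y ends_in_segment by blast+
      then show ?thesis
        using connected_Int_frontier[OF connected_segment(1)] by (metis frontier_cball)
    qed
    then obtain z where z: "z \<in> closed_segment x y" "z \<in> sphere c r"
      by (meson disjoint_iff)
    have "dist (?h x) (?h y) \<le> dist (f x) (f z) + dist (g z) (g y)"
      using x y eq[OF z(2)] dist_triangle[of "f x" "g y" "f z"] by simp
    also have "\<dots> \<le> max L M * dist x z + max L M * dist z y"
    proof (rule add_mono)
      have "dist (f x) (f z) \<le> L * dist x z" using lipschitz_onD[OF f x, of z] z(2) by simp
      also have "\<dots> \<le> max L M * dist x z" by (intro mult_right_mono) auto
      finally show "dist (f x) (f z) \<le> max L M * dist x z" .
      have "dist (g z) (g y) \<le> M * dist z y" using lipschitz_onD[OF g, of z y] by simp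
      also have "\<dots> \<le> max L M * dist z y" by (intro mult_right_mono) auto
      finally show "dist (g z) (g y) \<le> max L M * dist z y" .
    qed
    also have "\<dots> = max L M * dist x y"
      using z(1) by (simp only: between_mem_segment[symmetric] between distrib_left)
    finally show ?thesis .
  qed
  show ?thesis
  proof (rule lipschitz_onI)
    show "0 \<le> max L M" using lipschitz_on_nonneg[OF g] by simp
    fix x y
    consider "x \<in> cball c r" "y \<in> cball c r" | "x \<notin> cball c r" "y \<notin> cball c r"
      | "x \<in> cball c r" "y \<notin> cball c r" | "x \<notin> cball c r" "y \<in> cball c r" by blast
    then show "dist (?h x) (?h y) \<le> max L M * dist x y"
    proof cases
      case 1
      then have "dist (?h x) (?h y) \<le> L * dist x y" using lipschitz_onD[OF f] by simp
      also have "\<dots> \<le> max L M * dist x y" by (intro mult_right_mono) auto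
      finally show ?thesis .
    next
      case 2
      then have "dist (?h x) (?h y) \<le> M * dist x y" using lipschitz_onD[OF g] by simp
      also have "\<dots> \<le> max L M * dist x y" by (intro mult_right_mono) auto
      finally show ?thesis .
    qed (use *[of x y] *[of y x] in \<open>auto simp: dist_commute\<close>)
  qed
qed

section \<open>The retraction onto a ball and its derivatives\<close>

lemma closest_point_cball_0:
  fixes y :: "'a::euclidean_space"
  assumes "d \<ge> 0"
  shows "closest_point (cball 0 d) y = (if norm y \<le> d then y else (d / norm y) *\<^sub>R y)"
proof (cases "norm y \<le> d")
  case False
  then have y0: "y \<noteq> 0" using assms by auto
  have "(d / norm y) *\<^sub>R y = closest_point (cball 0 d) y"
  proof (rule closest_point_unique)
    show "\<forall>z\<in>cball 0 d. dist y ((d / norm y) *\<^sub>R y) \<le> dist y z"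
    proof
      fix z assume "z \<in> cball (0::'a) d"
      have "y - (d / norm y) *\<^sub>R y = (1 - d / norm y) *\<^sub>R y" by (simp add: algebra_simps)
      then have "dist y ((d / norm y) *\<^sub>R y) = \<bar>1 - d / norm y\<bar> * norm y" by (simp add: dist_norm)
      also have "\<dots> = norm y - d" using False y0 assms by (simp add: field_simps abs_if)
      also have "\<dots> \<le> dist y z" using \<open>z \<in> cball 0 d\<close> norm_triangle_ineq2[of y z] by (simp add: dist_norm)
      finally show "dist y ((d / norm y) *\<^sub>R y) \<le> dist y z" .
    qed
  qed (use assms False y0 in auto)
  then show ?thesis using False by simp
qed (simp add: closest_point_self)

text \<open>Differentiating the locally constant |u|^2 shows that the range of \<open>D\<close> is
  orthogonal to the nonzero vector \<open>u x\<close>, so \<open>D\<close> is not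
  surjective.\<close>

lemma det_has_derivative_sphere_eq_0:
  fixes u :: "real^'n \<Rightarrow> real^'n"
  assumes u: "(u has_derivative D) (at x)" and d: "d > 0" "\<forall>\<^sub>F y in nhds x. norm (u y) = d"
  shows "det (matrix D) = 0"
proof -
  have lin: "linear D" using u by (rule has_derivative_linear)
  have "((\<lambda>y. u y \<bullet> u y) has_derivative (\<lambda>h. u x \<bullet> D h + D h \<bullet> u x)) (at x)"
    by (rule has_derivative_inner[OF u u])
  moreover have "((\<lambda>y. u y \<bullet> u y) has_derivative (\<lambda>h. 0)) (at x)"
  proof (rule has_derivative_transform_eventually)
    show "((\<lambda>y. d\<^sup>2) has_derivative (\<lambda>h. 0)) (at x)" by simp
    show "\<forall>\<^sub>F y in at x. d\<^sup>2 = u y \<bullet> u y"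
      using d(2) unfolding eventually_at_filter
      by (rule eventually_mono) (simp flip: power2_norm_eq_inner)
    show "d\<^sup>2 = u x \<bullet> u x" using eventually_nhds_x_imp_x[OF d(2)] by (simp flip: power2_norm_eq_inner)
  qed simp
  ultimately have "(\<lambda>h. u x \<bullet> D h + D h \<bullet> u x) = (\<lambda>h. 0)" by (rule has_derivative_unique)
  then have orth: "u x \<bullet> D h = 0" for h by (simp add: inner_commute fun_eq_iff)
  have "\<not> surj D"
  proof
    assume "surj D"
    then obtain h where "D h = u x" by (metis surjD)
    then have "u x = 0" using orth[of h] by simp
    with eventually_nhds_x_imp_x[OF d(2)] d(1) show False by simp
  qed
  then have "\<not> inj D" using lin linear_injective_imp_surjective by blast
  then show ?thesis using det_nz_iff_inj[OF lin] by blast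
qed

text \<open>Near \<open>x\<close> the retracted map is the radial projection of \<open>u\<close>,
  which is differentiable and takes its values in the sphere of radius \<open>d\<close>.\<close>

lemma derivative_closest_point_cball_singular:
  fixes u :: "real^'n \<Rightarrow> real^'n"
  assumes u: "u differentiable (at x)" and d: "0 < d" "d < norm (u x)"
  obtains D where "((\<lambda>y. closest_point (cball 0 d) (u y)) has_derivative D) (at x)"
    "det (matrix D) = 0"
proof -
  have ux: "u x \<noteq> 0" using d by auto
  have "(\<lambda>y. (d / norm (u y)) *\<^sub>R u y) differentiable (at x)"
    using u ux by (intro derivative_intros differentiable_compose[of norm u] differentiable_norm_at) auto
  then obtain D where D: "((\<lambda>y. (d / norm (u y)) *\<^sub>R u y) has_derivative D) (at x)"
    unfolding differentiable_def by blast
  have "isCont u x" using u differentiable_imp_continuous_within by blast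
  then have "isCont (\<lambda>y. norm (u y)) x" by (intro continuous_intros)
  then have "(\<lambda>y. norm (u y)) \<midarrow>x\<rightarrow> norm (u x)" by (simp add: isCont_def)
  then have "\<forall>\<^sub>F y in at x. d < norm (u y)" using d(2) by (rule order_tendstoD)
  then have ev: "\<forall>\<^sub>F y in nhds x. d < norm (u y)"
    using d(2) by (simp add: eventually_nhds_conv_at)
  have ev2: "\<forall>\<^sub>F y in nhds x. (d / norm (u y)) *\<^sub>R u y = closest_point (cball 0 d) (u y)"
    using ev by (rule eventually_mono) (use d in \<open>simp add: closest_point_cball_0\<close>)
  show thesis
  proof
    show "((\<lambda>y. closest_point (cball 0 d) (u y)) has_derivative D) (at x)"
      using D ev2 eventually_nhds_x_imp_x[OF ev2]
      by (intro has_derivative_transform_eventually[OF D]) (auto simp: eventually_nhds_conv_at)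
    show "det (matrix D) = 0"
    proof (rule det_has_derivative_sphere_eq_0[OF D d(1)])
      show "\<forall>\<^sub>F y in nhds x. norm ((d / norm (u y)) *\<^sub>R u y) = d"
        using ev by (rule eventually_mono) (use d in auto)
    qed
  qed
qed

text \<open>This disposes of the points with \<open>norm (P x) = d\<close>, where the retraction of
  \<open>P\<close> may fail to be differentiable. An invertible affine map pulls the null sphere
  back to a null set.\<close>

lemma negligible_affine_vimage_sphere:
  fixes A :: "real^'n^'n"
  assumes "det A \<noteq> 0"
  shows "negligible {x. norm (A *v x + b) = d}"
proof -
  obtain B where B: "B ** A = mat 1"
    using assms invertible_det_nz[of A] by (auto simp: invertible_def)
  have "{x. norm (A *v x + b) = d} \<subseteq> (\<lambda>y. B *v (y - b)) ` sphere 0 d"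
  proof
    fix x assume "x \<in> {x. norm (A *v x + b) = d}"
    then show "x \<in> (\<lambda>y. B *v (y - b)) ` sphere 0 d"
      by (intro image_eqI[of _ _ "A *v x + b"]) (auto simp: matrix_vector_mul_assoc B)
  qed
  moreover have "negligible ((\<lambda>y. B *v (y - b)) ` sphere 0 d)"
  proof (rule negligible_differentiable_image_negligible)
    show "(\<lambda>y. B *v (y - b)) differentiable_on sphere 0 d"
      unfolding matrix_vector_mult_diff_distrib
      by (intro differentiable_on_diff differentiable_on_const linear_imp_differentiable_on) auto
  qed (auto simp: negligible_sphere)
  ultimately show ?thesis by (rule negligible_subset[rotated])
qed

text \<open>A polynomial blending weight that is 1 on the sphere and, raised to a high power, negligible
  on the compact set where \<open>P\<close> does not dominate \<open>G - P\<close>.\<close>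
lemma blend_nonvanishing:
  fixes P G :: "'a::euclidean_space \<Rightarrow> 'b::euclidean_space"
  assumes r: "r > 0" and P: "continuous_on (cball c r) P" and G: "continuous_on (cball c r) G"
    and close: "\<And>x. x \<in> sphere c r \<Longrightarrow> norm (G x - P x) < norm (P x)"
    and nz: "\<And>x. x \<in> cball c r \<Longrightarrow> G x \<noteq> 0"
  obtains k :: nat and m where "m > 0"
    "\<And>x. x \<in> cball c r \<Longrightarrow>
       m \<le> norm ((1 - ((norm (x - c))\<^sup>2 / r\<^sup>2) ^ k) *\<^sub>R G x + ((norm (x - c))\<^sup>2 / r\<^sup>2) ^ k *\<^sub>R P x)"
proof -
  define w where "w x = (norm (x - c))\<^sup>2 / r\<^sup>2" for x
  have w: "0 \<le> w x" "w x \<le> 1" if "x \<in> cball c r" for x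
    using that r by (auto simp: w_def dist_norm norm_minus_commute power_mono)
  have wcont: "continuous_on X w" for X
    unfolding w_def using r by (intro continuous_intros) auto
  have comp: "compact (cball c r)" and ne: "cball c r \<noteq> {}" using r by auto
  obtain g where g: "g > 0" "\<And>x. x \<in> cball c r \<Longrightarrow> g \<le> norm (G x)"
  proof -
    obtain x0 where "x0 \<in> cball c r" "\<forall>x\<in>cball c r. norm (G x0) \<le> norm (G x)"
      using continuous_attains_inf[OF comp ne continuous_on_norm[OF G]] by blast
    with nz that[of "norm (G x0)"] show thesis by auto
  qed
  have "bounded ((\<lambda>x. P x - G x) ` cball c r)"
    using compact_imp_bounded[OF compact_continuous_image[OF continuous_on_diff[OF P G] comp]]
    .
  then obtain M where M: "\<And>x. x \<in> cball c r \<Longrightarrow> norm (P x - G x) \<le> M"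
    unfolding bounded_iff by blast
  \<comment> \<open>\<open>T\<close> is where \<open>P\<close> fails to dominate
    \<open>G - P\<close>. By \<open>close\<close> it misses the sphere, so by compactness the weight
    stays below some q < 1 on it.\<close>
  define T where "T = {x \<in> cball c r. norm (P x) \<le> norm (G x - P x)}"
  have "\<exists>q<1. 0 \<le> q \<and> (\<forall>x\<in>T. w x \<le> q)"
  proof (cases "T = {}")
    case True
    then show ?thesis by (intro exI[of _ 0]) auto
  next
    case False
    have "closed T" unfolding T_def
      by (intro continuous_on_closed_Collect_le continuous_on_norm continuous_on_diff P G) auto
    then have "compact T"
      using compact_Int_closed[OF comp, of T] by (metis T_def Collect_subset inf.absorb_iff2)
    then obtain x1 where x1: "x1 \<in> T" "\<forall>x\<in>T. w x \<le> w x1"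
      using continuous_attains_sup[of T w] False
      by (metis (mono_tags, lifting) wcont)
    have "x1 \<notin> sphere c r" using close x1(1) by (force simp: T_def)
    then have "norm (x1 - c) < r" using x1(1) by (auto simp: T_def dist_norm norm_minus_commute)
    then have "w x1 < 1" using r by (simp add: w_def power_strict_mono)
    then show ?thesis using x1 w(1)[of x1] by (intro exI[of _ "w x1"]) (auto simp: T_def)
  qed
  then obtain q where q: "q < 1" "0 \<le> q" "\<And>x. x \<in> T \<Longrightarrow> w x \<le> q" by blast
  have "(\<lambda>k. q ^ k * M) \<longlonglongrightarrow> 0 * M"
    using q by (intro tendsto_mult LIMSEQ_realpow_zero tendsto_const)
  then have "\<forall>\<^sub>F k in sequentially. q ^ k * M < g"
    using g(1) by (auto dest: order_tendstoD(2))
  then obtain k where k: "q ^ k * M < g" by (auto simp: eventually_sequentially)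
  define H where "H x = (1 - w x ^ k) *\<^sub>R G x + w x ^ k *\<^sub>R P x" for x
  \<comment> \<open>On \<open>T\<close> the blend is \<open>G\<close> plus an error of norm at most
    \<open>q ^ k * M\<close>, which is less than \<open>g\<close>. Off \<open>T\<close> it is
    \<open>P\<close> plus an error smaller than \<open>P\<close>.\<close>
  have H: "H x \<noteq> 0" if x: "x \<in> cball c r" for x
  proof (cases "x \<in> T")
    case True
    have "w x ^ k * norm (P x - G x) \<le> q ^ k * M"
      using w[OF x] q(3)[OF True] M[OF x] q(2) by (intro mult_mono power_mono) auto
    then have "norm (w x ^ k *\<^sub>R (P x - G x)) < norm (G x)"
      using k g(2)[OF x] w[OF x] by simp
    moreover have "H x = G x + w x ^ k *\<^sub>R (P x - G x)" by (simp add: H_def algebra_simps)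
    ultimately show ?thesis by (metis add_eq_0_iff norm_minus_cancel less_irrefl)
  next
    case False
    then have lt: "norm (G x - P x) < norm (P x)" using x by (auto simp: T_def)
    have "norm ((1 - w x ^ k) *\<^sub>R (G x - P x)) \<le> 1 * norm (G x - P x)"
      unfolding norm_scaleR using w[OF x] power_le_one[OF w[OF x], of k]
      by (intro mult_right_mono) (auto simp: abs_if)
    moreover have "H x = P x + (1 - w x ^ k) *\<^sub>R (G x - P x)" by (simp add: H_def algebra_simps)
    ultimately show ?thesis using lt by (metis add_eq_0_iff norm_minus_cancel not_le mult_1)
  qed
  have "continuous_on (cball c r) (\<lambda>x. norm (H x))"
    unfolding H_def w_def using r by (intro continuous_intros P G) auto
  then obtain x0 where "x0 \<in> cball c r" "\<forall>x\<in>cball c r. norm (H x0) \<le> norm (H x)"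
    using continuous_attains_inf[OF comp ne] by blast
  with H[of x0] show thesis
    using that[of "norm (H x0)" k] by (auto simp: H_def w_def)
qed

text \<open>Retracting onto a small ball turns a zero-free map into one with singular derivative,
  whereas the retraction of \<open>P\<close> keeps determinants of a constant sign.\<close>
lemma coherently_oriented_rouche_wellorder:
  fixes P G :: "real^'n::{finite,wellorder} \<Rightarrow> real^'n::_"
  assumes co: "coherently_oriented_on U P" and r: "r > 0" and cb: "cball c r \<subseteq> U" and Pc: "P c = 0"
    and G: "continuous_on (cball c r) G"
    and close: "\<And>x. x \<in> sphere c r \<Longrightarrow> norm (G x - P x) < norm (P x)"
  shows "\<exists>x\<in>cball c r. G x = 0"
proof (rule ccontr)
  assume "\<not> ?thesis"
  then have nz: "\<And>x. x \<in> cball c r \<Longrightarrow> G x \<noteq> 0" by blast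
  obtain S \<sigma> where S: "selection_family S P" and P: "continuous_on UNIV P"
    and \<sigma>: "\<sigma> \<in> {-1, 1}" "\<forall>(A, b)\<in>S. active_on U P A b \<longrightarrow> sgn (det A) = \<sigma>"
    using co unfolding coherently_oriented_on_def by blast
  obtain L where L: "L-lipschitz_on UNIV P" using selection_family_lipschitz[OF S P] by blast
  obtain N0 where N0: "negligible N0"
    "\<And>x. x \<notin> N0 \<Longrightarrow> \<exists>(A, b)\<in>S. \<exists>V. open V \<and> x \<in> V \<and> (\<forall>y\<in>V. P y = A *v y + b)"
    using selection_family_locally_affine[OF S P] by blast
  obtain k m where m: "m > 0" and km: "\<And>x. x \<in> cball c r \<Longrightarrow>
     m \<le> norm ((1 - ((norm (x - c))\<^sup>2 / r\<^sup>2) ^ k) *\<^sub>R G x + ((norm (x - c))\<^sup>2 / r\<^sup>2) ^ k *\<^sub>R P x)"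
    using blend_nonvanishing[OF r continuous_on_subset[OF P subset_UNIV] G close nz] by blast
  define w where "w x = ((norm (x - c))\<^sup>2 / r\<^sup>2) ^ k" for x
  have w: "0 \<le> w x" "w x \<le> 1" if "x \<in> cball c r" for x
    using that r by (auto simp: w_def dist_norm norm_minus_commute power_mono power_le_one)
  have wpoly: "real_polynomial_function w"
  proof -
    have "real_polynomial_function (\<lambda>x. (x - c) \<bullet> b)" for b
      unfolding real_polynomial_function_eq
      by (intro polynomial_function_inner polynomial_function_diff) auto
    then have "real_polynomial_function (\<lambda>x. (x - c) \<bullet> (x - c))"
      by (subst euclidean_inner) (intro real_polynomial_function_sum real_polynomial_function.intros(4); simp)
    then have "real_polynomial_function (\<lambda>x. (inverse (r\<^sup>2) * ((x - c) \<bullet> (x - c))) ^ k)"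
      by (intro real_polynomial_function_power real_polynomial_function.intros(4) real_polynomial_function.intros(2))
    then show ?thesis by (simp add: w_def[abs_def] power2_norm_eq_inner divide_inverse mult.commute)
  qed
  \<comment> \<open>A polynomial in place of \<open>G\<close> makes the blend Lipschitz on the ball
    and differentiable wherever \<open>P\<close> is. The error m / 2 leaves half of the lower bound
    \<open>m\<close>.\<close>
  obtain Q where Q: "polynomial_function Q" "\<And>x. x \<in> cball c r \<Longrightarrow> norm (G x - Q x) < m / 2"
    using Stone_Weierstrass_polynomial_function[OF compact_cball G, of "m/2"] m by auto
  define H where "H x = (1 - w x) *\<^sub>R Q x + w x *\<^sub>R P x" for x
  have H_ge: "m / 2 \<le> norm (H x)" if x: "x \<in> cball c r" for x
  proof -
    have "(1 - w x) *\<^sub>R G x + w x *\<^sub>R P x = H x + (1 - w x) *\<^sub>R (G x - Q x)"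
      by (simp add: H_def algebra_simps)
    then have "m \<le> norm (H x) + \<bar>1 - w x\<bar> * norm (G x - Q x)"
      using km[OF x] norm_triangle_ineq[of "H x" "(1 - w x) *\<^sub>R (G x - Q x)"] by (simp add: w_def)
    also have "\<bar>1 - w x\<bar> * norm (G x - Q x) \<le> 1 * (m / 2)"
      using w[OF x] Q(2)[OF x] by (intro mult_mono) auto
    finally show ?thesis by simp
  qed
  obtain K where K: "K-lipschitz_on (cball c r) H"
  proof -
    have w1: "\<exists>L. L-lipschitz_on (cball c r) (\<lambda>x. 1 - w x)" "\<exists>L. L-lipschitz_on (cball c r) w"
      using lipschitz_on_real_polynomial_function[OF real_polynomial_function_diff[OF real_polynomial_function.intros(2) wpoly] bounded_cball]
        lipschitz_on_real_polynomial_function[OF wpoly bounded_cball] by blast+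
    have "\<exists>L. L-lipschitz_on (cball c r) (\<lambda>x. (1 - w x) *\<^sub>R Q x)"
      using w1 lipschitz_on_polynomial_function[OF Q(1), of "cball c r"]
      by (intro lipschitz_on_scaleR_bounded) auto
    moreover have "\<exists>L. L-lipschitz_on (cball c r) (\<lambda>x. w x *\<^sub>R P x)"
      using w1 lipschitz_on_subset[OF L subset_UNIV]
      by (intro lipschitz_on_scaleR_bounded) auto
    ultimately show thesis
      using lipschitz_on_add that unfolding H_def[abs_def] by blast
  qed
  \<comment> \<open>The weight is 1 on the sphere, so \<open>H\<close> continues there as
    \<open>P\<close>. Hence \<open>g0\<close> and \<open>P\<close> agree off the ball, as the
    comparison of integrals demands.\<close>
  define g0 where "g0 x = (if x \<in> cball c r then H x else P x)" for x
  have g0: "(max K L)-lipschitz_on UNIV g0"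
    unfolding g0_def
  proof (rule lipschitz_on_if_cball[OF K L])
    fix x assume "x \<in> sphere c r"
    then show "H x = P x" using r by (simp add: H_def w_def dist_norm norm_minus_commute)
  qed
  \<comment> \<open>Any positive radius below the lower bound m / 2 of \<open>norm (H x)\<close>
    serves: the retraction then sends the values of \<open>g0\<close> on the ball into a
    sphere.\<close>
  define d where "d = m / 4"
  have d: "d > 0" using m by (simp add: d_def)
  define \<psi> where "\<psi> = closest_point (cball (0::real^'n::_) d)"
  have \<psi>: "1-lipschitz_on UNIV \<psi>"
    unfolding \<psi>_def using d by (intro lipschitz_onI) (auto intro!: closest_point_lipschitz)
  \<comment> \<open>The three sets collect the points where \<open>P\<close> may fail to be locally
    affine, where \<open>g0\<close> is glued, and where the retraction of \<open>P\<close> changes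
    from the identity to the radial projection.\<close>
  define N where "N = N0 \<union> sphere c r \<union> (\<Union>s\<in>{s\<in>S. det (fst s) \<noteq> 0}. {x. norm (fst s *v x + snd s) = d})"
  have N: "negligible N"
  proof -
    have "finite {s\<in>S. det (fst s) \<noteq> 0}" using S by (simp add: selection_family_def)
    then show ?thesis unfolding N_def using N0(1)
      by (intro negligible_Un negligible_Union finite_imageI)
         (auto intro!: negligible_affine_vimage_sphere negligible_sphere)
  qed
  have affine: "\<exists>A. (P has_derivative (*v) A) (at x) \<and> sgn (det A) = \<sigma> \<and> norm (P x) \<noteq> d"
    if x: "x \<in> cball c r - N" for x
  proof -
    obtain A b V where V: "(A, b) \<in> S" "open V" "x \<in> V" "\<And>y. y \<in> V \<Longrightarrow> P y = A *v y + b"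
      using N0(2)[of x] x by (auto simp: N_def)
    have "x \<in> ball c r" using x by (auto simp: N_def less_le)
    then have "active_on U P A b"
      unfolding active_on_def using V cb ball_subset_cball
      by (intro exI[of _ "V \<inter> ball c r"]) blast
    then have sg: "sgn (det A) = \<sigma>" using \<sigma>(2) V(1) by blast
    have "((\<lambda>y. A *v y + b) has_derivative (*v) A) (at x)"
      by (auto intro!: derivative_eq_intros bounded_linear_imp_has_derivative)
    then have "(P has_derivative (*v) A) (at x)"
      by (rule has_derivative_transform_within_open[OF _ V(2,3)]) (simp add: V(4))
    moreover have "norm (P x) \<noteq> d"
    proof
      assume "norm (P x) = d"
      then have "x \<in> N" unfolding N_def using V sg \<sigma>(1) by (force intro!: UN_I[of "(A, b)"])
      with x show False by simp
    qed
    ultimately show ?thesis using sg by blast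
  qed
  \<comment> \<open>Where \<open>P\<close> is smaller than \<open>d\<close>, the retraction is the
    identity and the determinant is that of an active piece. Where \<open>P\<close> is larger, the
    derivative is singular. The factor \<sigma> makes both cases nonnegative, so nothing cancels in
    the integral.\<close>
  have "\<exists>D. ((\<lambda>y. \<psi> (P y)) has_derivative D) (at x) \<and> 0 \<le> \<sigma> * det (matrix D) \<and>
      (norm (P x) < d \<longrightarrow> 0 < \<sigma> * det (matrix D))" if x: "x \<in> cball c r - N" for x
  proof -
    obtain A where A: "(P has_derivative (*v) A) (at x)" "sgn (det A) = \<sigma>" "norm (P x) \<noteq> d"
      using affine[OF x] by blast
    show ?thesis
    proof (cases "norm (P x) < d")
      case True
      have "open {y. norm (P y) < d}"
        using P by (intro open_Collect_less continuous_intros)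
      then have "((\<lambda>y. \<psi> (P y)) has_derivative (*v) A) (at x)"
        using True by (intro has_derivative_transform_within_open[OF A(1)])
          (auto simp: \<psi>_def closest_point_self)
      moreover have "0 < \<sigma> * det A"
        using A(2) \<sigma>(1) by (auto simp: sgn_if split: if_splits)
      ultimately show ?thesis by (intro exI[of _ "(*v) A"]) simp
    next
      case False
      have "P differentiable (at x)" using A(1) by (auto simp: differentiable_def)
      then show ?thesis
        using derivative_closest_point_cball_singular[of P x d] False A(3) d unfolding \<psi>_def
        by (metis less_irrefl mult_zero_right order_refl linorder_neqE)
    qed
  qed
  then obtain f' where f': "\<And>x. x \<in> cball c r - N \<Longrightarrow> ((\<lambda>y. \<psi> (P y)) has_derivative f' x) (at x)"
    "\<And>x. x \<in> cball c r - N \<Longrightarrow> 0 \<le> \<sigma> * det (matrix (f' x))"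
    "\<And>x. x \<in> cball c r - N \<Longrightarrow> norm (P x) < d \<Longrightarrow> 0 < \<sigma> * det (matrix (f' x))"
    by metis
  have "\<exists>D. ((\<lambda>y. \<psi> (g0 y)) has_derivative D) (at x) \<and> det (matrix D) = 0" if x: "x \<in> cball c r - N" for x
  proof -
    have xb: "x \<in> ball c r" using x by (auto simp: N_def less_le)
    obtain A where A: "(P has_derivative (*v) A) (at x)" using affine[OF x] by blast
    have "P differentiable (at x)" using A by (auto simp: differentiable_def)
    moreover have "w differentiable (at x)" "Q differentiable (at x)"
      using wpoly Q(1) by (auto intro: differentiable_at_real_polynomial_function differentiable_at_polynomial_function)
    ultimately have "H differentiable (at x)"
      unfolding H_def[abs_def]
      by (intro differentiable_add differentiable_scaleR differentiable_diff differentiable_const)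
    moreover have "d < norm (H x)" using H_ge[of x] x m by (auto simp: d_def)
    ultimately obtain D where D: "((\<lambda>y. \<psi> (H y)) has_derivative D) (at x)" "det (matrix D) = 0"
      using derivative_closest_point_cball_singular[of H x d] d unfolding \<psi>_def by blast
    have "((\<lambda>y. \<psi> (g0 y)) has_derivative D) (at x)"
      by (rule has_derivative_transform_within_open[OF D(1) open_ball xb]) (auto simp: g0_def)
    with D show ?thesis by blast
  qed
  then obtain g' where g': "\<And>x. x \<in> cball c r - N \<Longrightarrow> ((\<lambda>y. \<psi> (g0 y)) has_derivative g' x) (at x)"
    "\<And>x. x \<in> cball c r - N \<Longrightarrow> det (matrix (g' x)) = 0"
    by metis
  let ?M = "lebesgue_on (cball c r - N)"
  have lf: "(1 * L)-lipschitz_on UNIV (\<lambda>y. \<psi> (P y))" "(1 * max K L)-lipschitz_on UNIV (\<lambda>y. \<psi> (g0 y))"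
    by (rule lipschitz_on_compose2[OF L lipschitz_on_subset[OF \<psi> subset_UNIV]]
             lipschitz_on_compose2[OF g0 lipschitz_on_subset[OF \<psi> subset_UNIV]])+
  have out: "\<psi> (P x) = \<psi> (g0 x)" if "x \<notin> cball c r" for x using that by (simp add: g0_def)
  note int = integral_det_derivative_eq[OF lmeasurable_cball N lf(1) f'(1) lf(2) g'(1) out]
  have "(LINT x|?M. det (matrix (g' x))) = (LINT x|?M. 0)"
    by (intro Bochner_Integration.integral_cong) (auto simp: g'(2))
  then have "(LINT x|?M. \<sigma> * det (matrix (f' x))) = 0"
    using int by simp
  then have "AE x in ?M. \<sigma> * det (matrix (f' x)) = 0"
    using int(1) f'(2) by (subst integral_nonneg_eq_0_iff_AE [symmetric]) (auto intro!: AE_I2)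
  then obtain Z where Z: "{x \<in> cball c r - N. \<sigma> * det (matrix (f' x)) \<noteq> 0} \<subseteq> Z" "Z \<in> null_sets ?M"
    unfolding eventually_ae_filter by auto
  have "cball c r - N \<in> sets lebesgue"
    using N by (intro sets.Diff) (auto simp: negligible_imp_sets)
  then have "negligible Z"
    using Z(2) by (simp add: null_sets_restrict_space negligible_iff_null_sets)
  \<comment> \<open>On \<open>W\<close>, off \<open>N\<close>, the determinant is nonzero, whereas
    the vanishing integral makes it zero almost everywhere. So \<open>W\<close> would be null,
    although it is open and contains \<open>c\<close>.\<close>
  define W where "W = ball c r \<inter> {y. norm (P y) < d}"
  have "W \<subseteq> Z \<union> N"
  proof
    fix x assume x: "x \<in> W"
    show "x \<in> Z \<union> N"
    proof (cases "x \<in> N")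
      case False
      with x have "x \<in> cball c r - N" "norm (P x) < d" by (auto simp: W_def)
      from f'(3)[OF this] this(1) Z(1) show ?thesis by auto
    qed simp
  qed
  then have "negligible W"
    by (rule negligible_subset[OF negligible_Un[OF \<open>negligible Z\<close> N]])
  moreover have "open W" unfolding W_def
    using P by (intro open_Int open_ball open_Collect_less continuous_intros)
  moreover have "c \<in> W" using r d Pc by (simp add: W_def)
  ultimately show False using open_not_negligible by blast
qed

text \<open>Change of variables is only available for index types of class \<open>wellorder\<close>; a finite type is
  transported to the following well-ordered copy.\<close>

typedef 'a ordered_copy = "UNIV :: 'a set" ..

lemma bij_Rep_ordered_copy: "bij Rep_ordered_copy"
  by (metis Abs_ordered_copy_inverse Rep_ordered_copy_inverse UNIV_I bijI')

instance ordered_copy :: (finite) finite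
  by standard (metis bij_Rep_ordered_copy bij_betw_finite finite)

instantiation ordered_copy :: (finite) wellorder
begin

definition less_eq_ordered_copy :: "'a ordered_copy \<Rightarrow> 'a ordered_copy \<Rightarrow> bool" where
  "x \<le> y \<longleftrightarrow> to_nat_on UNIV (Rep_ordered_copy x) \<le> to_nat_on UNIV (Rep_ordered_copy y)"

definition less_ordered_copy :: "'a ordered_copy \<Rightarrow> 'a ordered_copy \<Rightarrow> bool" where
  "x < y \<longleftrightarrow> to_nat_on UNIV (Rep_ordered_copy x) < to_nat_on UNIV (Rep_ordered_copy y)"

instance
proof
  fix x y z :: "'a ordered_copy" and P :: "'a ordered_copy \<Rightarrow> bool"
  show "x < y \<longleftrightarrow> x \<le> y \<and> \<not> y \<le> x" "x \<le> x" "x \<le> y \<Longrightarrow> y \<le> z \<Longrightarrow> x \<le> z" "x \<le> y \<or> y \<le> x"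
    by (auto simp: less_eq_ordered_copy_def less_ordered_copy_def)
  show "x = y" if "x \<le> y" "y \<le> x"
  proof -
    have "Rep_ordered_copy x = Rep_ordered_copy y"
      using that inj_on_to_nat_on[of "UNIV :: 'a set"]
      by (auto simp: less_eq_ordered_copy_def inj_on_def countable_finite)
    then show ?thesis by (simp add: Rep_ordered_copy_inject)
  qed
  show "P x" if "\<And>x. (\<And>y. y < x \<Longrightarrow> P y) \<Longrightarrow> P x"
  proof (induction x rule: measure_induct_rule[of "\<lambda>x. to_nat_on UNIV (Rep_ordered_copy x)"])
    case (less x)
    show ?case by (rule that, rule less) (simp add: less_ordered_copy_def)
  qed
qed

end

text \<open>Conjugation by \<open>h\<close> is a bijection between the permutations of the two index
  types that preserves signs, and it matches the products in the two expansions.\<close>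

lemma det_reindex:
  fixes A :: "real^'n^'n" and h :: "'m::finite \<Rightarrow> 'n"
  assumes h: "bij h"
  shows "det (\<chi> i j. A $ h i $ h j) = det A"
proof -
  have mp: "map_permutation UNIV h p k = h (p (inv h k))"
    and mp': "map_permutation UNIV (inv h) q i = inv h (q (h i))" for p q k i
    using h by (auto simp: map_permutation_def bij_is_surj surj_imp_inj_inv bij_imp_bij_inv inv_inv_eq)
  have ih: "inv h (h i) = i" "h (inv h k) = k" for i k
    using h by (auto simp: bij_is_inj bij_is_surj surj_f_inv_f)
  show ?thesis
    unfolding det_def
  proof (rule sum.reindex_bij_witness[of _ "map_permutation UNIV (inv h)" "map_permutation UNIV h"])
    fix p :: "'m \<Rightarrow> 'm" assume "p \<in> {p. p permutes UNIV}"
    then have p: "p permutes UNIV" by simp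
    show "map_permutation UNIV (inv h) (map_permutation UNIV h p) = p"
      by (auto simp: fun_eq_iff mp mp' ih)
    show "map_permutation UNIV h p \<in> {p. p permutes UNIV}"
      using map_permutation_permutes[of h UNIV UNIV p] h p by simp
    have "sign (map_permutation UNIV h p) = sign p"
      using h p by (intro sign_map_permutation) (auto simp: bij_is_inj)
    moreover have "(\<Prod>k\<in>UNIV. A $ k $ map_permutation UNIV h p k) = (\<Prod>i\<in>UNIV. A $ h i $ h (p i))"
      using prod.reindex_bij_betw[OF h, of "\<lambda>k. A $ k $ map_permutation UNIV h p k"] by (simp add: mp ih)
    ultimately show "of_int (sign (map_permutation UNIV h p)) * (\<Prod>k\<in>UNIV. A $ k $ map_permutation UNIV h p k) =
        of_int (sign p) * (\<Prod>i\<in>UNIV. (\<chi> i j. A $ h i $ h j) $ i $ p i)"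
      by simp
  next
    fix q :: "'n \<Rightarrow> 'n" assume "q \<in> {p. p permutes UNIV}"
    then show "map_permutation UNIV (inv h) q \<in> {p. p permutes UNIV}"
      using map_permutation_permutes[of "inv h" UNIV UNIV q] h by (simp add: bij_imp_bij_inv)
    show "map_permutation UNIV h (map_permutation UNIV (inv h) q) = q"
      by (auto simp: fun_eq_iff mp mp' ih)
  qed
qed

lemma norm_reindex:
  fixes x :: "real^'n" and h :: "'m::finite \<Rightarrow> 'n"
  assumes "bij h"
  shows "norm (\<chi> i. x $ h i) = norm x"
  using sum.reindex_bij_betw[OF assms, of "\<lambda>k. (x $ k)\<^sup>2"] by (simp add: norm_vec_def L2_set_def)

text \<open>Relabelling the coordinates is a linear isometry \<open>T\<close> that turns each matrix
  into one with the same determinant. Active pieces, orientation and the condition on the sphere all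
  carry over to the well-ordered index type.\<close>

theorem coherently_oriented_rouche:
  fixes P G :: "real^'n \<Rightarrow> real^'n"
  assumes co: "coherently_oriented_on U P" and r: "r > 0" and cb: "cball c r \<subseteq> U" and Pc: "P c = 0"
    and G: "continuous_on (cball c r) G"
    and close: "\<And>x. x \<in> sphere c r \<Longrightarrow> norm (G x - P x) < norm (P x)"
  shows "\<exists>x\<in>cball c r. G x = 0"
proof -
  let ?h = "Rep_ordered_copy :: 'n ordered_copy \<Rightarrow> 'n"
  define T where "T x = (\<chi> i. x $ ?h i)" for x :: "real^'n"
  define T' where "T' y = (\<chi> k. y $ Abs_ordered_copy k)" for y :: "real^'n ordered_copy"
  define M where "M A = (\<chi> i j. A $ ?h i $ ?h j)" for A :: "real^'n^'n"
  have T'T [simp]: "T' (T x) = x" and TT' [simp]: "T (T' y) = y" for x y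
    by (auto simp: T_def T'_def vec_eq_iff Abs_ordered_copy_inverse Rep_ordered_copy_inverse)
  have nT [simp]: "norm (T x) = norm x" for x
    unfolding T_def by (rule norm_reindex[OF bij_Rep_ordered_copy])
  have Tdiff: "T x - T y = T (x - y)" and Tadd: "T x + T y = T (x + y)" for x y
    by (auto simp: T_def vec_eq_iff)
  have Tdist [simp]: "dist (T x) (T y) = dist x y" for x y by (simp add: dist_norm Tdiff)
  have T'dist [simp]: "dist x (T' y) = dist (T x) y" for x y
    using Tdist[of x "T' y"] by simp
  have T0: "T x = 0 \<longleftrightarrow> x = 0" for x by (metis nT norm_eq_zero)
  have Tinj: "T x = T y \<longleftrightarrow> x = y" for x y by (metis T'T)
  have "(\<Sum>j\<in>UNIV. A $ ?h i $ ?h j * x $ ?h j) = (\<Sum>j\<in>UNIV. A $ ?h i $ j * x $ j)"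
    for A :: "real^'n^'n" and x i
    by (rule sum.reindex_bij_betw[OF bij_Rep_ordered_copy])
  then have TM: "M A *v T x = T (A *v x)" for A x
    by (simp add: M_def T_def matrix_vector_mult_def vec_eq_iff)
  have detM: "det (M A) = det A" for A
    unfolding M_def by (rule det_reindex[OF bij_Rep_ordered_copy])
  have contT: "continuous_on X T" and contT': "continuous_on Y T'" for X Y
    unfolding T_def T'_def by (intro continuous_on_vec_lambda continuous_intros)+
  obtain S \<sigma> where S: "selection_family S P" and P: "continuous_on UNIV P"
    and \<sigma>: "\<sigma> \<in> {-1, 1}" "\<forall>(A, b)\<in>S. active_on U P A b \<longrightarrow> sgn (det A) = \<sigma>"
    using co unfolding coherently_oriented_on_def by blast
  define P' where "P' y = T (P (T' y))" for y
  define G' where "G' y = T (G (T' y))" for y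
  define S' where "S' = (\<lambda>(A, b). (M A, T b)) ` S"
  have affine: "P' y = M A *v y + T b \<longleftrightarrow> P (T' y) = A *v T' y + b" for A b y
  proof -
    have "M A *v y + T b = T (A *v T' y + b)"
      using TM[of A "T' y"] by (simp add: Tadd)
    then show ?thesis by (simp add: P'_def Tinj)
  qed
  have sel: "selection_family S' P'"
  proof -
    have "\<exists>(A', b')\<in>S'. P' y = A' *v y + b'" for y
      using S affine unfolding selection_family_def S'_def by fastforce
    then show ?thesis using S by (simp add: selection_family_def S'_def)
  qed
  have act: "active_on U P A b" if act': "active_on (T' -` U) P' (M A) (T b)" for A b
  proof -
    obtain V where V: "open V" "V \<noteq> {}" "V \<subseteq> T' -` U" "\<And>y. y \<in> V \<Longrightarrow> P' y = M A *v y + T b"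
      using act' unfolding active_on_def by blast
    have "open (T -` V)" using V(1) contT[of UNIV] by (simp add: continuous_on_open_vimage)
    moreover have "T -` V \<noteq> {}" using V(2) by (metis TT' ex_in_conv vimage_eq)
    moreover have "T -` V \<subseteq> U" using V(3) by auto
    moreover have "P x = A *v x + b" if "x \<in> T -` V" for x
      using V(4)[of "T x"] affine[of "T x" A b] that by simp
    ultimately show ?thesis unfolding active_on_def by blast
  qed
  have "continuous_on UNIV P'"
    unfolding P'_def
    by (intro continuous_on_compose2[OF contT[of UNIV]] continuous_on_compose2[OF P contT']) auto
  moreover have "sgn (det A') = \<sigma>" if "(A', b') \<in> S'" "active_on (T' -` U) P' A' b'" for A' b'
    using that act \<sigma>(2) by (auto simp: S'_def detM)
  ultimately have "coherently_oriented_on (T' -` U) P'"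
    unfolding coherently_oriented_on_def using sel \<sigma>(1) by blast
  moreover have "cball (T c) r \<subseteq> T' -` U"
  proof
    fix y assume "y \<in> cball (T c) r"
    then have "T' y \<in> cball c r" by simp
    then show "y \<in> T' -` U" using cb by blast
  qed
  moreover have "P' (T c) = 0" by (simp add: P'_def Pc T0)
  moreover have "continuous_on (cball (T c) r) G'"
    unfolding G'_def
    by (intro continuous_on_compose2[OF contT[of UNIV]] continuous_on_compose2[OF G contT']) auto
  moreover have "norm (G' y - P' y) < norm (P' y)" if "y \<in> sphere (T c) r" for y
    using close[of "T' y"] that by (simp add: G'_def P'_def Tdiff)
  ultimately obtain y where "y \<in> cball (T c) r" "G' y = 0"
    using coherently_oriented_rouche_wellorder[of "T' -` U" P' r "T c" G'] r by blast
  then show ?thesis by (intro bexI[of _ "T' y"]) (auto simp: G'_def T0)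
qed

section \<open>Second-order accuracy of secant linearizations\<close>

text \<open>The intermediate point is located by its distances to both endpoints, which covers
  either order of x and y as well as x = y.\<close>

lemma symmetric_MVT:
  fixes f :: "real \<Rightarrow> real"
  assumes "\<And>t. t \<in> cball t0 u \<Longrightarrow> (f has_real_derivative f' t) (at t)"
    and "x \<in> cball t0 u" "y \<in> cball t0 u"
  obtains z where "z \<in> cball t0 u" "\<bar>z - y\<bar> \<le> \<bar>x - y\<bar>" "\<bar>z - x\<bar> \<le> \<bar>x - y\<bar>" "f x - f y = f' z * (x - y)"
proof -
  have *: "\<exists>z. y' < z \<and> z < x' \<and> f x' - f y' = (x' - y') * f' z"
    if "y' < x'" "x' \<in> cball t0 u" "y' \<in> cball t0 u" for x' y'
    by (rule MVT2[OF that(1)]) (use that assms(1) in \<open>auto simp: dist_real_def\<close>)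
  consider "x = y" | "y < x" | "x < y" by linarith
  then show thesis
  proof cases
    case 1
    then show thesis using that[of x] assms by simp
  next
    case 2
    then obtain z where "y < z" "z < x" "f x - f y = (x - y) * f' z" using * assms by blast
    then show thesis using that[of z] assms by (auto simp: dist_real_def)
  next
    case 3
    then obtain z where "x < z" "z < y" "f y - f x = (y - x) * f' z" using * assms by blast
    then show thesis using that[of z] assms by (auto simp: dist_real_def algebra_simps)
  qed
qed

definition secant_slope :: "(real \<Rightarrow> real) \<Rightarrow> real \<Rightarrow> real \<Rightarrow> real" where
  "secant_slope f a b = (if a = b then deriv f ((a + b) / 2) else (f b - f a) / (b - a))"

text \<open>The slope is the derivative at a point e whose distance to each reference point is at
  most |b - a|. With p the reference point nearer to x and p' the other one, the error is (f' z - f'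
  e) (x - p) for some z with |z - p| \<le> |x - p|. The factor 3 arises from |z - e| \<le> |x - p| +
  |p' - p| \<le> 2 |x - p| + |x - p'| \<le> 3 |x - p'|.\<close>

lemma secant_slope_estimate:
  fixes f :: "real \<Rightarrow> real"
  assumes der: "\<And>t. t \<in> cball t0 u \<Longrightarrow> (f has_real_derivative deriv f t) (at t)"
    and lip: "L-lipschitz_on (cball t0 u) (deriv f)"
    and a: "a \<in> cball t0 u" and b: "b \<in> cball t0 u" and x: "x \<in> cball t0 u"
  shows "\<bar>f x - ((f a + f b) / 2 + secant_slope f a b * (x - (a + b) / 2))\<bar> \<le> 3 * L * \<bar>x - a\<bar> * \<bar>x - b\<bar>"
proof -
  define c where "c = secant_slope f a b"
  obtain e where e: "e \<in> cball t0 u" "\<bar>e - a\<bar> \<le> \<bar>b - a\<bar>" "\<bar>e - b\<bar> \<le> \<bar>b - a\<bar>" "c = deriv f e"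
  proof (cases "a = b")
    case True
    then show thesis using that[of a] a by (simp add: c_def secant_slope_def)
  next
    case False
    obtain z where "z \<in> cball t0 u" "\<bar>z - a\<bar> \<le> \<bar>b - a\<bar>" "\<bar>z - b\<bar> \<le> \<bar>b - a\<bar>" "f b - f a = deriv f z * (b - a)"
      using symmetric_MVT[OF der b a] by blast
    then show thesis using that[of z] False by (simp add: c_def secant_slope_def)
  qed
  have c: "c * (b - a) = f b - f a" by (simp add: c_def secant_slope_def)
  have L: "L \<ge> 0" using lip by (rule lipschitz_on_nonneg)
  have key: "\<bar>f x - f p - c * (x - p)\<bar> \<le> 3 * L * \<bar>x - p\<bar> * \<bar>x - p'\<bar>"
    if le: "\<bar>x - p\<bar> \<le> \<bar>x - p'\<bar>" and p: "p \<in> cball t0 u" and ep: "\<bar>e - p\<bar> \<le> \<bar>p' - p\<bar>" for p p'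
  proof -
    obtain z where z: "z \<in> cball t0 u" "\<bar>z - p\<bar> \<le> \<bar>x - p\<bar>" "f x - f p = deriv f z * (x - p)"
      using symmetric_MVT[OF der x p] by blast
    have "\<bar>deriv f z - deriv f e\<bar> \<le> L * \<bar>z - e\<bar>"
      using lipschitz_onD[OF lip z(1) e(1)] by (simp add: dist_real_def)
    also have "\<dots> \<le> L * (3 * \<bar>x - p'\<bar>)"
    proof (rule mult_left_mono)
      have "\<bar>z - e\<bar> \<le> \<bar>z - p\<bar> + \<bar>e - p\<bar>" "\<bar>p' - p\<bar> \<le> \<bar>x - p\<bar> + \<bar>x - p'\<bar>" by linarith+
      then show "\<bar>z - e\<bar> \<le> 3 * \<bar>x - p'\<bar>" using z(2) ep le by linarith
    qed (rule L)
    finally have "\<bar>deriv f z - c\<bar> * \<bar>x - p\<bar> \<le> L * (3 * \<bar>x - p'\<bar>) * \<bar>x - p\<bar>"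
      using e(4) by (intro mult_right_mono) auto
    moreover have "f x - f p - c * (x - p) = (deriv f z - c) * (x - p)"
      using z(3) by (simp add: algebra_simps)
    ultimately show ?thesis by (simp add: abs_mult mult_ac)
  qed
  \<comment> \<open>The secant line passes through both points of the graph, so it can be recentred
    from the midpoint to either one.\<close>
  have fa: "f x - ((f a + f b) / 2 + c * (x - (a + b) / 2)) = f x - f a - c * (x - a)"
    and fb: "f x - ((f a + f b) / 2 + c * (x - (a + b) / 2)) = f x - f b - c * (x - b)"
    using c by (simp_all add: field_simps)
  show ?thesis
    unfolding c_def[symmetric]
  proof (cases "\<bar>x - a\<bar> \<le> \<bar>x - b\<bar>")
    case True
    then show "\<bar>f x - ((f a + f b) / 2 + c * (x - (a + b) / 2))\<bar> \<le> 3 * L * \<bar>x - a\<bar> * \<bar>x - b\<bar>"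
      unfolding fa using key[of a b] a e(2) by simp
  next
    case False
    then show "\<bar>f x - ((f a + f b) / 2 + c * (x - (a + b) / 2))\<bar> \<le> 3 * L * \<bar>x - a\<bar> * \<bar>x - b\<bar>"
      unfolding fb using key[of b a] b e(3) by (simp add: abs_minus_commute mult_ac)
  qed
qed

text \<open>\<open>v\<close> is an intermediate value and \<open>w a b\<close> its secant linearization at \<open>a\<close>, \<open>b\<close>.\<close>
definition secant_approx ::
    "'a::real_normed_vector \<Rightarrow> ('a \<Rightarrow> real) \<Rightarrow> ('a \<Rightarrow> 'a \<Rightarrow> 'a \<Rightarrow> real) \<Rightarrow> bool" where
  "secant_approx c v w \<longleftrightarrow> (\<exists>K\<ge>0. \<forall>\<^sub>F r in at_right 0. \<forall>a\<in>ball c r. \<forall>b\<in>ball c r. \<forall>x\<in>ball c r.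
     \<bar>v x - v a\<bar> \<le> K * norm (x - a) \<and> \<bar>v x - w a b x\<bar> \<le> K * (norm (x - a) * norm (x - b)))"

lemma secant_approxE:
  assumes "secant_approx c v w"
  obtains K where "K \<ge> 0" "\<forall>\<^sub>F r in at_right 0. \<forall>a\<in>ball c r. \<forall>b\<in>ball c r. \<forall>x\<in>ball c r.
     \<bar>v x - v a\<bar> \<le> K * norm (x - a) \<and> \<bar>v x - w a b x\<bar> \<le> K * (norm (x - a) * norm (x - b))"
  using assms unfolding secant_approx_def by blast

lemma secant_approx_exact:
  assumes "K \<ge> 0" "\<And>x a. \<bar>v x - v a\<bar> \<le> K * norm (x - a)" "\<And>a b x. w a b x = v x"
  shows "secant_approx c v w"
  unfolding secant_approx_def using assms by (intro exI[of _ K]) auto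

lemma secant_approx_linear_combination:
  assumes "secant_approx c v w" "secant_approx c v' w'"
  shows "secant_approx c (\<lambda>x. s * v x + t * v' x) (\<lambda>a b x. s * w a b x + t * w' a b x)"
proof -
  obtain K where K: "K \<ge> 0" "\<forall>\<^sub>F r in at_right 0. \<forall>a\<in>ball c r. \<forall>b\<in>ball c r. \<forall>x\<in>ball c r.
     \<bar>v x - v a\<bar> \<le> K * norm (x - a) \<and> \<bar>v x - w a b x\<bar> \<le> K * (norm (x - a) * norm (x - b))"
    using assms(1) by (rule secant_approxE)
  obtain K' where K': "K' \<ge> 0" "\<forall>\<^sub>F r in at_right 0. \<forall>a\<in>ball c r. \<forall>b\<in>ball c r. \<forall>x\<in>ball c r.
     \<bar>v' x - v' a\<bar> \<le> K' * norm (x - a) \<and> \<bar>v' x - w' a b x\<bar> \<le> K' * (norm (x - a) * norm (x - b))"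
    using assms(2) by (rule secant_approxE)
  \<comment> \<open>Used twice: with n = |x - a| for the increments and with n = |x - a| |x - b| for
    the linearization errors.\<close>
  have lc: "\<bar>(s * y + t * y') - (s * z + t * z')\<bar> \<le> (\<bar>s\<bar> * K + \<bar>t\<bar> * K') * n"
    if "\<bar>y - z\<bar> \<le> K * n" "\<bar>y' - z'\<bar> \<le> K' * n" for y y' z z' n
  proof -
    have "(s * y + t * y') - (s * z + t * z') = s * (y - z) + t * (y' - z')" by (simp add: algebra_simps)
    also have "\<bar>\<dots>\<bar> \<le> \<bar>s\<bar> * \<bar>y - z\<bar> + \<bar>t\<bar> * \<bar>y' - z'\<bar>"
      using abs_triangle_ineq[of "s * (y - z)" "t * (y' - z')"] by (simp add: abs_mult)
    also have "\<dots> \<le> \<bar>s\<bar> * (K * n) + \<bar>t\<bar> * (K' * n)"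
      using that by (intro add_mono mult_left_mono) auto
    finally show ?thesis by (simp add: algebra_simps)
  qed
  show ?thesis
    unfolding secant_approx_def
  proof (intro exI[of _ "\<bar>s\<bar> * K + \<bar>t\<bar> * K'"] conjI)
    show "\<forall>\<^sub>F r in at_right 0. \<forall>a\<in>ball c r. \<forall>b\<in>ball c r. \<forall>x\<in>ball c r.
       \<bar>(s * v x + t * v' x) - (s * v a + t * v' a)\<bar> \<le> (\<bar>s\<bar> * K + \<bar>t\<bar> * K') * norm (x - a) \<and>
       \<bar>(s * v x + t * v' x) - (s * w a b x + t * w' a b x)\<bar>
         \<le> (\<bar>s\<bar> * K + \<bar>t\<bar> * K') * (norm (x - a) * norm (x - b))"
      using K(2) K'(2) by eventually_elim (blast intro: lc)
  qed (use K(1) K'(1) in auto)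
qed

text \<open>The rule for \<open>Abs\<close> applies the absolute value itself to the linearized
  argument. The kink causes no error, and the error of the argument does not grow.\<close>

lemma secant_approx_abs:
  assumes "secant_approx c v w"
  shows "secant_approx c (\<lambda>x. \<bar>v x\<bar>) (\<lambda>a b x. \<bar>w a b x\<bar>)"
proof -
  obtain K where K: "K \<ge> 0" "\<forall>\<^sub>F r in at_right 0. \<forall>a\<in>ball c r. \<forall>b\<in>ball c r. \<forall>x\<in>ball c r.
     \<bar>v x - v a\<bar> \<le> K * norm (x - a) \<and> \<bar>v x - w a b x\<bar> \<le> K * (norm (x - a) * norm (x - b))"
    using assms by (rule secant_approxE)
  have "\<forall>\<^sub>F r in at_right 0. \<forall>a\<in>ball c r. \<forall>b\<in>ball c r. \<forall>x\<in>ball c r.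
     \<bar>\<bar>v x\<bar> - \<bar>v a\<bar>\<bar> \<le> K * norm (x - a) \<and> \<bar>\<bar>v x\<bar> - \<bar>w a b x\<bar>\<bar> \<le> K * (norm (x - a) * norm (x - b))"
    using K(2) by eventually_elim (blast intro: order_trans[OF abs_triangle_ineq3])
  with K(1) show ?thesis unfolding secant_approx_def by blast
qed

text \<open>On small balls an intermediate value stays near its value at the centre. This bounds the
  factors of products and keeps arguments inside the domains of elementals.\<close>

lemma secant_approx_bounded:
  assumes K: "K \<ge> 0" "\<forall>\<^sub>F r in at_right 0. \<forall>a\<in>ball c r. \<forall>b\<in>ball c r. \<forall>x\<in>ball c r.
     \<bar>v x - v a\<bar> \<le> K * norm (x - a) \<and> \<bar>v x - w a b x\<bar> \<le> K * (norm (x - a) * norm (x - b))"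
    and u: "u > 0"
  shows "\<forall>\<^sub>F r in at_right 0. \<forall>x\<in>ball c r. \<bar>v x - v c\<bar> \<le> (u::real)"
proof -
  have "\<forall>\<^sub>F r in at_right (0::real). 0 < r \<and> r < u / (K + 1)"
    using u K(1) by (auto simp: eventually_at_right_field intro!: exI[of _ "u / (K+1)"])
  with K(2) show ?thesis
  proof eventually_elim
    case (elim r)
    show ?case
    proof
      fix x assume x: "x \<in> ball c r"
      have "\<bar>v x - v c\<bar> \<le> K * norm (x - c)" using elim x by auto
      also have "\<dots> \<le> (K + 1) * (u / (K + 1))"
        using elim x K(1) by (intro mult_mono) (auto simp: dist_norm norm_minus_commute)
      finally show "\<bar>v x - v c\<bar> \<le> u" using K(1) by simp
    qed
  qed
qed

lemma product_estimate:
  fixes v1 v2 v1' v2' :: real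
  assumes "\<bar>v1 - v1'\<bar> \<le> K1 * n" "\<bar>v2 - v2'\<bar> \<le> K2 * n" "\<bar>v2\<bar> \<le> B2" "\<bar>v1'\<bar> \<le> B1"
  shows "\<bar>v1 * v2 - v1' * v2'\<bar> \<le> (B1 * K2 + B2 * K1) * n"
proof -
  have "0 \<le> B1" "0 \<le> B2" using assms(3,4) by linarith+
  have "v1 * v2 - v1' * v2' = v1' * (v2 - v2') + v2 * (v1 - v1')" by (simp add: algebra_simps)
  also have "\<bar>\<dots>\<bar> \<le> \<bar>v1'\<bar> * \<bar>v2 - v2'\<bar> + \<bar>v2\<bar> * \<bar>v1 - v1'\<bar>"
    using abs_triangle_ineq[of "v1' * (v2 - v2')" "v2 * (v1 - v1')"] by (simp add: abs_mult)
  also have "\<dots> \<le> B1 * (K2 * n) + B2 * (K1 * n)"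
    using assms \<open>0 \<le> B1\<close> \<open>0 \<le> B2\<close> by (intro add_mono mult_mono) auto
  finally show ?thesis by (simp add: algebra_simps)
qed

text \<open>The error of the secant rule for products is bilinear: it equals
  \<open>(\<alpha>1 * \<beta>2 + \<beta>1 * \<alpha>2) / 2 + m1 * e2 + e1 * m2\<close>, where \<open>\<alpha>\<close>, \<open>\<beta>\<close> are the differences of the
  factors to their values at the reference points, \<open>m\<close> the averages and \<open>e\<close> the errors of the factors.\<close>
lemma secant_product_estimate:
  fixes y1 y2 a1 a2 b1 b2 w1 w2 :: real
  defines "m1 \<equiv> (a1 + b1) / 2" and "m2 \<equiv> (a2 + b2) / 2"
  assumes a: "\<bar>y1 - a1\<bar> \<le> K1 * s" "\<bar>y2 - a2\<bar> \<le> K2 * s"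
    and b: "\<bar>y1 - b1\<bar> \<le> K1 * t" "\<bar>y2 - b2\<bar> \<le> K2 * t"
    and w: "\<bar>y1 - w1\<bar> \<le> K1 * (s * t)" "\<bar>y2 - w2\<bar> \<le> K2 * (s * t)"
    and B: "\<bar>a1\<bar> \<le> B1" "\<bar>b1\<bar> \<le> B1" "\<bar>a2\<bar> \<le> B2" "\<bar>b2\<bar> \<le> B2"
  shows "\<bar>y1 * y2 - ((a1 * a2 + b1 * b2) / 2 + (m1 * (w2 - m2) + (w1 - m1) * m2))\<bar>
    \<le> (K1 * K2 + (B1 * K2 + B2 * K1)) * (s * t)"
proof -
  let ?E1 = "(y1 - a1) * (y2 - b2)" and ?E2 = "(y1 - b1) * (y2 - a2)"
  have "y1 * y2 - ((a1 * a2 + b1 * b2) / 2 + (m1 * (w2 - m2) + (w1 - m1) * m2))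
    = ?E1 / 2 + ?E2 / 2 + m1 * (y2 - w2) + m2 * (y1 - w1)"
    unfolding m1_def m2_def by (simp add: field_simps)
  also have "\<bar>\<dots>\<bar> \<le> \<bar>?E1\<bar> / 2 + \<bar>?E2\<bar> / 2 + \<bar>m1 * (y2 - w2)\<bar> + \<bar>m2 * (y1 - w1)\<bar>"
    by linarith
  also have "\<dots> \<le> (K1 * s) * (K2 * t) / 2 + (K1 * t) * (K2 * s) / 2 + B1 * (K2 * (s * t)) + B2 * (K1 * (s * t))"
  proof (intro add_mono divide_right_mono)
    have nonneg: "0 \<le> K1 * s" "0 \<le> K1 * t" "0 \<le> K1 * (s * t)" "0 \<le> K2 * (s * t)" "0 \<le> B1" "0 \<le> B2"
      by (rule order_trans[OF abs_ge_zero], rule a b w B)+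
    show "\<bar>?E1\<bar> \<le> K1 * s * (K2 * t)" "\<bar>?E2\<bar> \<le> K1 * t * (K2 * s)"
      unfolding abs_mult using a b nonneg by (auto intro!: mult_mono)
    have "\<bar>m1\<bar> \<le> B1" "\<bar>m2\<bar> \<le> B2" using B by (auto simp: m1_def m2_def)
    then show "\<bar>m1 * (y2 - w2)\<bar> \<le> B1 * (K2 * (s * t))" "\<bar>m2 * (y1 - w1)\<bar> \<le> B2 * (K1 * (s * t))"
      unfolding abs_mult using w nonneg by (auto intro!: mult_mono)
  qed simp_all
  also have "\<dots> = (K1 * K2 + (B1 * K2 + B2 * K1)) * (s * t)" by (simp add: algebra_simps)
  finally show ?thesis .
qed

lemma secant_approx_mult:
  assumes "secant_approx c v1 w1" "secant_approx c v2 w2"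
  shows "secant_approx c (\<lambda>x. v1 x * v2 x) (\<lambda>a b x. (v1 a * v2 a + v1 b * v2 b) / 2 +
    ((v1 a + v1 b) / 2 * (w2 a b x - (v2 a + v2 b) / 2) +
     (w1 a b x - (v1 a + v1 b) / 2) * ((v2 a + v2 b) / 2)))"
proof -
  obtain K1 where K1: "K1 \<ge> 0" "\<forall>\<^sub>F r in at_right 0. \<forall>a\<in>ball c r. \<forall>b\<in>ball c r. \<forall>x\<in>ball c r.
     \<bar>v1 x - v1 a\<bar> \<le> K1 * norm (x - a) \<and> \<bar>v1 x - w1 a b x\<bar> \<le> K1 * (norm (x - a) * norm (x - b))"
    using assms(1) by (rule secant_approxE)
  obtain K2 where K2: "K2 \<ge> 0" "\<forall>\<^sub>F r in at_right 0. \<forall>a\<in>ball c r. \<forall>b\<in>ball c r. \<forall>x\<in>ball c r.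
     \<bar>v2 x - v2 a\<bar> \<le> K2 * norm (x - a) \<and> \<bar>v2 x - w2 a b x\<bar> \<le> K2 * (norm (x - a) * norm (x - b))"
    using assms(2) by (rule secant_approxE)
  define B1 where "B1 = \<bar>v1 c\<bar> + 1"
  define B2 where "B2 = \<bar>v2 c\<bar> + 1"
  define K where "K = K1 * K2 + (B1 * K2 + B2 * K1)"
  have K: "B1 * K2 + B2 * K1 \<le> K" "0 \<le> K" using K1(1) K2(1) by (auto simp: K_def B1_def B2_def)
  show ?thesis
    unfolding secant_approx_def
  proof (intro exI[of _ K] conjI)
    show "\<forall>\<^sub>F r in at_right 0. \<forall>a\<in>ball c r. \<forall>b\<in>ball c r. \<forall>x\<in>ball c r.
       \<bar>v1 x * v2 x - v1 a * v2 a\<bar> \<le> K * norm (x - a) \<and>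
       \<bar>v1 x * v2 x - ((v1 a * v2 a + v1 b * v2 b) / 2 +
          ((v1 a + v1 b) / 2 * (w2 a b x - (v2 a + v2 b) / 2) +
           (w1 a b x - (v1 a + v1 b) / 2) * ((v2 a + v2 b) / 2)))\<bar> \<le> K * (norm (x - a) * norm (x - b))"
      using K1(2) K2(2) secant_approx_bounded[OF K1 zero_less_one] secant_approx_bounded[OF K2 zero_less_one]
    proof eventually_elim
      case (elim r)
      have B: "\<bar>v1 x\<bar> \<le> B1" "\<bar>v2 x\<bar> \<le> B2" if "x \<in> ball c r" for x
        using elim(3,4) that unfolding B1_def B2_def by fastforce+
      show ?case
      proof (intro ballI conjI)
        fix a b x assume *: "a \<in> ball c r" "b \<in> ball c r" "x \<in> ball c r"
        have "\<bar>v1 x * v2 x - v1 a * v2 a\<bar> \<le> (B1 * K2 + B2 * K1) * norm (x - a)"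
          using elim(1,2) * B by (intro product_estimate) auto
        also have "\<dots> \<le> K * norm (x - a)" using K by (intro mult_right_mono) auto
        finally show "\<bar>v1 x * v2 x - v1 a * v2 a\<bar> \<le> K * norm (x - a)" .
        show "\<bar>v1 x * v2 x - ((v1 a * v2 a + v1 b * v2 b) / 2 +
          ((v1 a + v1 b) / 2 * (w2 a b x - (v2 a + v2 b) / 2) +
           (w1 a b x - (v1 a + v1 b) / 2) * ((v2 a + v2 b) / 2)))\<bar> \<le> K * (norm (x - a) * norm (x - b))"
          unfolding K_def using elim(1,2) * B by (intro secant_product_estimate) auto
      qed
    qed
  qed (rule K)
qed

text \<open>The error splits into the one-variable secant error at \<open>v x\<close>, bounded by
  the product of two increments of \<open>v\<close>, and the slope times the error of the argument.
  These give the summands \<open>3 * L * (K * K)\<close> and \<open>M * K\<close> of the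
  constant.\<close>

lemma secant_approx_elemental:
  fixes \<phi> :: "real \<Rightarrow> real"
  assumes "secant_approx c v w" and u: "u > 0"
    and der: "\<And>t. t \<in> cball (v c) u \<Longrightarrow> (\<phi> has_real_derivative deriv \<phi> t) (at t)"
    and lip: "L-lipschitz_on (cball (v c) u) (deriv \<phi>)"
  shows "secant_approx c (\<lambda>x. \<phi> (v x)) (\<lambda>a b x. (\<phi> (v a) + \<phi> (v b)) / 2 +
    secant_slope \<phi> (v a) (v b) * (w a b x - (v a + v b) / 2))"
proof -
  obtain K where K: "K \<ge> 0" "\<forall>\<^sub>F r in at_right 0. \<forall>a\<in>ball c r. \<forall>b\<in>ball c r. \<forall>x\<in>ball c r.
     \<bar>v x - v a\<bar> \<le> K * norm (x - a) \<and> \<bar>v x - w a b x\<bar> \<le> K * (norm (x - a) * norm (x - b))"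
    using assms(1) by (rule secant_approxE)
  have L: "0 \<le> L" using lip by (rule lipschitz_on_nonneg)
  define M where "M = \<bar>deriv \<phi> (v c)\<bar> + L * u"
  have M0: "0 \<le> M" using L u by (simp add: M_def)
  have M: "\<bar>deriv \<phi> t\<bar> \<le> M" if t: "t \<in> cball (v c) u" for t
  proof -
    have "\<bar>deriv \<phi> t - deriv \<phi> (v c)\<bar> \<le> L * \<bar>t - v c\<bar>"
      using lipschitz_onD[OF lip t, of "v c"] u by (simp add: dist_real_def)
    also have "\<dots> \<le> L * u" using t L by (intro mult_left_mono) (auto simp: dist_real_def)
    finally show ?thesis by (simp add: M_def)
  qed
  have slope: "\<bar>secant_slope \<phi> s t\<bar> \<le> M" and incr: "\<bar>\<phi> t - \<phi> s\<bar> \<le> M * \<bar>t - s\<bar>"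
    if st: "s \<in> cball (v c) u" "t \<in> cball (v c) u" for s t
  proof -
    obtain z where z: "z \<in> cball (v c) u" "\<phi> t - \<phi> s = deriv \<phi> z * (t - s)"
      using symmetric_MVT[OF der st(2,1)] by blast
    then show "\<bar>\<phi> t - \<phi> s\<bar> \<le> M * \<bar>t - s\<bar>" using M[of z] by (simp add: abs_mult mult_right_mono)
    show "\<bar>secant_slope \<phi> s t\<bar> \<le> M"
      using z M[of z] M[of s] st by (auto simp: secant_slope_def)
  qed
  define C where "C = M * K + 3 * L * (K * K)"
  have C: "M * K \<le> C" "0 \<le> C" using M0 K(1) L by (auto simp: C_def)
  show ?thesis
    unfolding secant_approx_def
  proof (intro exI[of _ C] conjI)
    show "\<forall>\<^sub>F r in at_right 0. \<forall>a\<in>ball c r. \<forall>b\<in>ball c r. \<forall>x\<in>ball c r.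
       \<bar>\<phi> (v x) - \<phi> (v a)\<bar> \<le> C * norm (x - a) \<and>
       \<bar>\<phi> (v x) - ((\<phi> (v a) + \<phi> (v b)) / 2 + secant_slope \<phi> (v a) (v b) * (w a b x - (v a + v b) / 2))\<bar>
         \<le> C * (norm (x - a) * norm (x - b))"
      using K(2) secant_approx_bounded[OF K u]
    proof eventually_elim
      case (elim r)
      have D: "v x \<in> cball (v c) u" if "x \<in> ball c r" for x
        using elim(2) that by (auto simp: dist_real_def abs_minus_commute)
      show ?case
      proof (intro ballI conjI)
        fix a b x assume *: "a \<in> ball c r" "b \<in> ball c r" "x \<in> ball c r"
        have va: "\<bar>v x - v a\<bar> \<le> K * norm (x - a)" and vb: "\<bar>v x - v b\<bar> \<le> K * norm (x - b)"
          and vw: "\<bar>v x - w a b x\<bar> \<le> K * (norm (x - a) * norm (x - b))"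
          using elim(1) * by blast+
        have "\<bar>\<phi> (v x) - \<phi> (v a)\<bar> \<le> M * \<bar>v x - v a\<bar>" using D * by (intro incr) auto
        also have "\<dots> \<le> M * (K * norm (x - a))" using va M0 by (intro mult_left_mono) auto
        also have "\<dots> \<le> C * norm (x - a)"
          using mult_right_mono[OF C(1), of "norm (x - a)"] by simp
        finally show "\<bar>\<phi> (v x) - \<phi> (v a)\<bar> \<le> C * norm (x - a)" .
        let ?s = "secant_slope \<phi> (v a) (v b)"
        have "\<phi> (v x) - ((\<phi> (v a) + \<phi> (v b)) / 2 + ?s * (w a b x - (v a + v b) / 2)) =
          (\<phi> (v x) - ((\<phi> (v a) + \<phi> (v b)) / 2 + ?s * (v x - (v a + v b) / 2))) + ?s * (v x - w a b x)"
          by (simp add: algebra_simps)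
        also have "\<bar>\<dots>\<bar> \<le> \<bar>\<phi> (v x) - ((\<phi> (v a) + \<phi> (v b)) / 2 + ?s * (v x - (v a + v b) / 2))\<bar>
            + \<bar>?s\<bar> * \<bar>v x - w a b x\<bar>"
          unfolding abs_mult[symmetric] by (rule abs_triangle_ineq)
        also have "\<dots> \<le> 3 * L * \<bar>v x - v a\<bar> * \<bar>v x - v b\<bar> + \<bar>?s\<bar> * \<bar>v x - w a b x\<bar>"
          using secant_slope_estimate[OF der lip D D D] * by simp
        also have "\<dots> \<le> 3 * L * (K * norm (x - a)) * (K * norm (x - b)) + M * (K * (norm (x - a) * norm (x - b)))"
          using va vb vw slope D * L K(1) M0 by (intro add_mono mult_mono) auto
        also have "\<dots> = C * (norm (x - a) * norm (x - b))" by (simp add: C_def algebra_simps)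
        finally show "\<bar>\<phi> (v x) - ((\<phi> (v a) + \<phi> (v b)) / 2 + ?s * (w a b x - (v a + v b) / 2))\<bar>
          \<le> C * (norm (x - a) * norm (x - b))" .
      qed
    qed
  qed (rule C)
qed

section \<open>Execution of procedures and propagation of the estimate\<close>

lemma run_append: "run f (p @ q) vs = run f q (run f p vs)"
  by (simp add: run_def)

lemma run_prefix: "\<exists>zs. run f p vs = vs @ zs \<and> length zs = length p"
proof (induction p rule: rev_induct)
  case (snoc e p)
  then show ?case by (auto simp: run_def)
qed (simp add: run_def)

lemma run_nth_input: "i < length vs \<Longrightarrow> run f p vs ! i = vs ! i"
  using run_prefix[of f p vs] by (auto simp: nth_append)

lemma length_run: "length (run f p vs) = length vs + length p"
  using run_prefix[of f p vs] by auto

text \<open>Values once computed never change and an instruction reads only its operands, so it may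
  be evaluated on the final list instead of the prefix available at its turn.\<close>

lemma run_nth_instr:
  assumes k: "k < length p" and op: "\<And>j. j \<in> operands (p ! k) \<Longrightarrow> j < length vs + k"
    and cong: "\<And>us us'. (\<And>j. j \<in> operands (p ! k) \<Longrightarrow> us ! j = us' ! j) \<Longrightarrow> f us (p ! k) = f us' (p ! k)"
  shows "run f p vs ! (length vs + k) = f (run f p vs) (p ! k)"
proof -
  let ?us = "run f (take k p) vs"
  have p: "p = take k p @ [p ! k] @ drop (Suc k) p" using k by (simp add: id_take_nth_drop)
  have len: "length ?us = length vs + k" using k by (simp add: length_run)
  have run: "run f p vs = run f (drop (Suc k) p) (?us @ [f ?us (p ! k)])"
    by (subst p) (simp only: run_append, simp add: run_def)
  then have "run f p vs ! (length vs + k) = f ?us (p ! k)"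
    using len by (simp add: run_nth_input nth_append)
  also have "\<dots> = f (run f p vs) (p ! k)"
  proof (rule cong)
    fix j assume "j \<in> operands (p ! k)"
    then have "j < length ?us" using op len by simp
    then show "?us ! j = run f p vs ! j" unfolding run by (simp add: run_nth_input nth_append)
  qed
  finally show ?thesis .
qed

lemma length_coords [simp]: "length (coords (x::real^'n)) = CARD('n)"
  by (simp add: coords_def)

lemma eval_instr_cong:
  "(\<And>j. j \<in> operands e \<Longrightarrow> vs ! j = vs' ! j) \<Longrightarrow> eval_instr vs e = eval_instr vs' e"
  by (cases e) auto

lemma secant_instr_cong:
  "(\<And>j. j \<in> operands e \<Longrightarrow> ds ! j = ds' ! j) \<Longrightarrow> secant_instr us ws ds e = secant_instr us ws ds' e"
  by (cases e) auto

text \<open>In terms of average plus increment, each secant rule becomes the combination of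
  linearizations treated by one of the closure lemmas for \<open>secant_approx\<close>. Induction
  along the procedure then applies them.\<close>

lemma secant_approx_values:
  fixes c :: "real^'n"
  assumes lib: "elemental_library \<Phi>" and proc: "procedure \<Phi> CARD('n) p" and wd: "well_defined p c"
    and i: "i < CARD('n) + length p"
  shows "secant_approx c (\<lambda>x. proc_values p x ! i)
    (\<lambda>a b x. avg (proc_values p a) (proc_values p b) i +
       run (secant_instr (proc_values p a) (proc_values p b)) p (coords (x - midpoint a b)) ! i)"
  using i
proof (induction i rule: less_induct)
  case (less i)
  define v where "v j x = proc_values p x ! j" for j and x :: "real^'n"
  define dv where "dv j a b x = run (secant_instr (proc_values p a) (proc_values p b)) p (coords (x - midpoint a b)) ! j"
    for j and a b x :: "real^'n"
  define w where "w j a b x = (v j a + v j b) / 2 + dv j a b x" for j a b x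
  have IH: "secant_approx c (v j) (w j)" if "j < i" for j
    using less.IH[OF that] less.prems that unfolding v_def[abs_def] w_def[abs_def] dv_def avg_def by simp
  have avg: "avg (proc_values p a) (proc_values p b) j = (v j a + v j b) / 2" for a b j
    by (simp add: avg_def v_def)
  have "secant_approx c (v i) (w i)"
  proof (cases "i < CARD('n)")
    case True
    have vi: "v i x = x $ from_nat_into UNIV i" for x
      using True by (simp add: v_def proc_values_def run_nth_input) (simp add: coords_def)
    have "w i a b x = v i x" for a b x
      using True by (simp add: w_def vi dv_def run_nth_input) (simp add: coords_def midpoint_def algebra_simps)
    moreover have "\<bar>v i x - v i a\<bar> \<le> 1 * norm (x - a)" for x a
      using component_le_norm_cart[of "x - a"] by (simp add: vi)
    ultimately show ?thesis by (intro secant_approx_exact[of 1]) auto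
  next
    case False
    define k where "k = i - CARD('n)"
    have ik: "i = CARD('n) + k" and k: "k < length p" using False less.prems by (auto simp: k_def)
    have op: "j < i" if "j \<in> operands (p ! k)" for j
      using proc that k unfolding procedure_def ik by blast
    have op': "j < length (coords y) + k" if "j \<in> operands (p ! k)" for j and y :: "real^'n"
      using op[OF that] by (simp add: ik)
    have vi: "v i x = eval_instr (proc_values p x) (p ! k)" for x
      using run_nth_instr[of k p "coords x" eval_instr, OF k op' eval_instr_cong] by (simp add: v_def proc_values_def ik)
    have di: "dv i a b x = secant_instr (proc_values p a) (proc_values p b)
        (run (secant_instr (proc_values p a) (proc_values p b)) p (coords (x - midpoint a b))) (p ! k)" for a b x
      using run_nth_instr[of k p "coords (x - midpoint a b)"
          "secant_instr (proc_values p a) (proc_values p b)", OF k op' secant_instr_cong]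
      by (simp add: dv_def ik)
    show ?thesis
    proof (cases "p ! k")
      case (Const t)
      then have "v i x = t" "w i a b x = t" for a b x
        by (simp_all add: vi di w_def)
      then show ?thesis by (intro secant_approx_exact[of 0]) auto
    next
      case (Add j l)
      then have j: "j < i" "l < i" using op by auto
      have vi': "v i x = v j x + v l x" for x
        unfolding vi Add by (simp add: v_def)
      have di': "dv i a b x = dv j a b x + dv l a b x" for a b x
        unfolding di Add by (simp add: dv_def)
      have "v i = (\<lambda>x. 1 * v j x + 1 * v l x)" "w i = (\<lambda>a b x. 1 * w j a b x + 1 * w l a b x)"
        by (auto simp: fun_eq_iff vi' w_def di' field_simps)
      then show ?thesis using secant_approx_linear_combination[OF IH[OF j(1)] IH[OF j(2)], of 1 1] by simp
    next
      case (Sub j l)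
      then have j: "j < i" "l < i" using op by auto
      have vi': "v i x = v j x - v l x" for x
        unfolding vi Sub by (simp add: v_def)
      have di': "dv i a b x = dv j a b x - dv l a b x" for a b x
        unfolding di Sub by (simp add: dv_def)
      have "v i = (\<lambda>x. 1 * v j x + (-1) * v l x)" "w i = (\<lambda>a b x. 1 * w j a b x + (-1) * w l a b x)"
        by (auto simp: fun_eq_iff vi' w_def di' field_simps)
      then show ?thesis using secant_approx_linear_combination[OF IH[OF j(1)] IH[OF j(2)], of 1 "-1"] by simp
    next
      case (Mul j l)
      then have j: "j < i" "l < i" using op by auto
      have vi': "v i x = v j x * v l x" for x
        unfolding vi Mul by (simp add: v_def)
      have di': "dv i a b x = (v j a + v j b) / 2 * dv l a b x + dv j a b x * ((v l a + v l b) / 2)" for a b x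
        unfolding di Mul by (simp add: dv_def avg)
      have "v i = (\<lambda>x. v j x * v l x)"
        by (simp add: fun_eq_iff vi')
      moreover have "w i = (\<lambda>a b x. (v j a * v l a + v j b * v l b) / 2 +
          ((v j a + v j b) / 2 * (w l a b x - (v l a + v l b) / 2) +
           (w j a b x - (v j a + v j b) / 2) * ((v l a + v l b) / 2)))"
        by (simp add: fun_eq_iff w_def di' vi')
      ultimately show ?thesis using secant_approx_mult[OF IH[OF j(1)] IH[OF j(2)]] by simp
    next
      case (Abs j)
      then have j: "j < i" using op by auto
      have vi': "v i x = \<bar>v j x\<bar>" for x
        unfolding vi Abs by (simp add: v_def)
      have di': "dv i a b x = \<bar>(v j a + v j b) / 2 + dv j a b x\<bar> - (\<bar>v j a\<bar> + \<bar>v j b\<bar>) / 2" for a b x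
        unfolding di Abs by (simp add: dv_def avg) (simp add: v_def)
      have "v i = (\<lambda>x. \<bar>v j x\<bar>)" "w i = (\<lambda>a b x. \<bar>w j a b x\<bar>)"
        by (auto simp: fun_eq_iff vi' w_def di')
      then show ?thesis using secant_approx_abs[OF IH[OF j]] by simp
    next
      case (Uni e j)
      obtain D \<phi> where e: "e = (D, \<phi>)" by (cases e)
      have j: "j < i" using Uni op by auto
      have mem: "Uni (D, \<phi>) j \<in> set p" using Uni k e by (metis nth_mem)
      then have D\<Phi>: "(D, \<phi>) \<in> \<Phi>" using proc unfolding procedure_def by blast
      then have D: "open D" "\<phi> differentiable_on D"
        and loc: "\<forall>t\<in>D. \<exists>u>0. \<exists>L. L-lipschitz_on (cball t u \<inter> D) (deriv \<phi>)"
        using lib unfolding elemental_library_def by auto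
      have vD: "v j c \<in> D" using wd mem unfolding well_defined_def v_def by blast
      obtain u L where u: "u > 0" "L-lipschitz_on (cball (v j c) u \<inter> D) (deriv \<phi>)" using loc vD by blast
      obtain u' where u': "u' > 0" "cball (v j c) u' \<subseteq> D" using D(1) vD open_contains_cball by blast
      have lip: "L-lipschitz_on (cball (v j c) (min u u')) (deriv \<phi>)"
        using u' by (intro lipschitz_on_subset[OF u(2)]) auto
      have der: "(\<phi> has_real_derivative deriv \<phi> t) (at t)" if "t \<in> cball (v j c) (min u u')" for t
      proof -
        have "t \<in> D" using that u' by auto
        then have "\<phi> differentiable (at t)"
          using D by (simp add: differentiable_on_eq_differentiable_at)
        then show ?thesis by (simp add: DERIV_deriv_iff_real_differentiable)
      qed
      have vi': "v i x = \<phi> (v j x)" for x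
        unfolding vi Uni e by (simp add: v_def)
      have di': "dv i a b x = secant_slope \<phi> (v j a) (v j b) * dv j a b x" for a b x
        unfolding di Uni e secant_slope_def v_def by (simp add: dv_def avg_def)
      have "v i = (\<lambda>x. \<phi> (v j x))"
        by (simp add: fun_eq_iff vi')
      moreover have "w i = (\<lambda>a b x. (\<phi> (v j a) + \<phi> (v j b)) / 2 +
          secant_slope \<phi> (v j a) (v j b) * (w j a b x - (v j a + v j b) / 2))"
        by (simp add: fun_eq_iff w_def di' vi')
      ultimately show ?thesis
        using secant_approx_elemental[OF IH[OF j] _ der lip] u u' by simp
    qed
  qed
  then show ?case
    unfolding v_def[abs_def] w_def[abs_def] dv_def avg_def by simp
qed

lemma proc_fun_secant_lin_estimate:
  fixes c :: "real^'n"
  assumes lib: "elemental_library \<Phi>" and proc: "procedure \<Phi> CARD('n) p" and wd: "well_defined p c"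
  obtains K where "K \<ge> 0" "\<forall>\<^sub>F r in at_right 0. \<forall>a\<in>ball c r. \<forall>b\<in>ball c r. \<forall>x\<in>ball c r.
     norm (proc_fun p x - secant_lin p a b x) \<le> K * (norm (x - a) * norm (x - b))"
proof -
  \<comment> \<open>The list has \<open>CARD('n) + length p\<close> entries, so the last
    \<open>CARD('n)\<close> of them start at position \<open>length p\<close>.\<close>
  define idx where "idx i = length p + to_nat_on (UNIV :: 'n set) i" for i :: 'n
  have idx: "idx i < CARD('n) + length p" for i
    using to_nat_on_finite[of "UNIV :: 'n set"] unfolding idx_def bij_betw_def by auto
  define w where "w i a b x = avg (proc_values p a) (proc_values p b) i +
       run (secant_instr (proc_values p a) (proc_values p b)) p (coords (x - midpoint a b)) ! i"
    for i and a b x :: "real^'n"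
  have pf: "proc_fun p x $ i = proc_values p x ! idx i" for x :: "real^'n" and i
    by (simp add: proc_fun_def last_coords_def idx_def proc_values_def length_run)
  have sl: "secant_lin p a b x $ i = w (idx i) a b x" for a b x :: "real^'n" and i
    by (simp add: secant_lin_def pf w_def avg_def secant_incr_def last_coords_def length_run idx_def)
  have "\<forall>i. \<exists>K. K \<ge> 0 \<and> (\<forall>\<^sub>F r in at_right 0. \<forall>a\<in>ball c r. \<forall>b\<in>ball c r. \<forall>x\<in>ball c r.
      \<bar>proc_fun p x $ i - secant_lin p a b x $ i\<bar> \<le> K * (norm (x - a) * norm (x - b)))"
  proof
    fix i
    obtain K where "K \<ge> 0" "\<forall>\<^sub>F r in at_right 0. \<forall>a\<in>ball c r. \<forall>b\<in>ball c r. \<forall>x\<in>ball c r.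
      \<bar>proc_values p x ! idx i - proc_values p a ! idx i\<bar> \<le> K * norm (x - a) \<and>
      \<bar>proc_values p x ! idx i - w (idx i) a b x\<bar> \<le> K * (norm (x - a) * norm (x - b))"
      using secant_approx_values[OF lib proc wd idx[of i]] unfolding w_def by (rule secant_approxE)
    then show "\<exists>K. K \<ge> 0 \<and> (\<forall>\<^sub>F r in at_right 0. \<forall>a\<in>ball c r. \<forall>b\<in>ball c r. \<forall>x\<in>ball c r.
      \<bar>proc_fun p x $ i - secant_lin p a b x $ i\<bar> \<le> K * (norm (x - a) * norm (x - b)))"
      unfolding pf sl by (intro exI[of _ K]) (auto elim: eventually_mono)
  qed
  from choice[OF this] obtain K where K: "\<And>i. K i \<ge> 0" "\<And>i. \<forall>\<^sub>F r in at_right 0. \<forall>a\<in>ball c r. \<forall>b\<in>ball c r. \<forall>x\<in>ball c r.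
      \<bar>proc_fun p x $ i - secant_lin p a b x $ i\<bar> \<le> K i * (norm (x - a) * norm (x - b))"
    by blast
  have "\<forall>\<^sub>F r in at_right 0. \<forall>i\<in>UNIV. \<forall>a\<in>ball c r. \<forall>b\<in>ball c r. \<forall>x\<in>ball c r.
      \<bar>proc_fun p x $ i - secant_lin p a b x $ i\<bar> \<le> K i * (norm (x - a) * norm (x - b))"
    using K(2) by (intro eventually_ball_finite) auto
  then have "\<forall>\<^sub>F r in at_right 0. \<forall>a\<in>ball c r. \<forall>b\<in>ball c r. \<forall>x\<in>ball c r.
     norm (proc_fun p x - secant_lin p a b x) \<le> sum K UNIV * (norm (x - a) * norm (x - b))"
  proof (rule eventually_mono, intro ballI)
    fix r a b x
    assume *: "\<forall>i\<in>UNIV. \<forall>a\<in>ball c r. \<forall>b\<in>ball c r. \<forall>x\<in>ball c r.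
      \<bar>proc_fun p x $ i - secant_lin p a b x $ i\<bar> \<le> K i * (norm (x - a) * norm (x - b))"
      "a \<in> ball c r" "b \<in> ball c r" "x \<in> ball c r"
    have "norm (proc_fun p x - secant_lin p a b x) \<le> (\<Sum>i\<in>UNIV. \<bar>(proc_fun p x - secant_lin p a b x) $ i\<bar>)"
      by (rule norm_le_l1_cart)
    also have "\<dots> \<le> (\<Sum>i\<in>UNIV. K i * (norm (x - a) * norm (x - b)))"
      using * by (intro sum_mono) auto
    finally show "norm (proc_fun p x - secant_lin p a b x) \<le> sum K UNIV * (norm (x - a) * norm (x - b))"
      by (simp add: sum_distrib_right)
  qed
  moreover have "0 \<le> sum K UNIV" using K(1) by (intro sum_nonneg)
  ultimately show thesis using that by blast
qed

lemma tangent_lin_eq_secant_lin: "tangent_lin p a = secant_lin p a a"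
proof -
  let ?v = "proc_values p a"
  have "secant_instr ?v ?v ds e = tangent_instr ?v ds e" for ds e
    by (cases e) (simp_all add: avg_def)
  then have "secant_instr ?v ?v = tangent_instr ?v" by (intro ext)
  then show ?thesis
    by (intro ext) (simp add: tangent_lin_def secant_lin_def tangent_incr_def secant_incr_def)
qed

section \<open>Local convergence of Newton iterations\<close>

lemma continuous_on_secant_lin: "continuous_on UNIV (secant_lin p a b)"
proof -
  have step: "continuous_on UNIV (\<lambda>x. secant_instr us ws (h x) e)"
    if "\<And>j. continuous_on UNIV (\<lambda>x::real^'n. h x ! j)" for us ws e and h :: "real^'n \<Rightarrow> real list"
    using that by (cases e) (auto intro!: continuous_intros)
  show ?thesis
    unfolding secant_lin_def secant_incr_def
    by (intro continuous_on_add continuous_on_const continuous_on_last_coords_run step)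
qed

text \<open>With c from the lower bound on \<open>P\<close> and g from the second-order estimate,
  the error e of a Newton step satisfies c e \<le> g ((e + ea) (e + eb) + e^2), where ea and eb are
  the errors of \<open>a\<close> and \<open>b\<close>. On a small ball every term containing e on
  the right is absorbed on the left, which leaves a multiple of ea eb.\<close>

proposition secant_newton_local_estimate:
  fixes xs :: "real^'n"
  assumes lib: "elemental_library \<Phi>" and comp: "computes \<Phi> p F"
    and wd: "\<forall>\<^sub>F x in nhds xs. well_defined p x" and U: "open U" "xs \<in> U" and root: "F xs = 0"
    and co: "coherently_oriented_on U (tangent_lin p xs)"
  obtains R K where "R > 0" "K > 0" "K * R \<le> 1 / 2"
    "\<And>a b. a \<in> ball xs R \<Longrightarrow> b \<in> ball xs R \<Longrightarrow> secant_newton_defined p a b"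
    "\<And>a b x. a \<in> ball xs R \<Longrightarrow> b \<in> ball xs R \<Longrightarrow> x \<in> secant_newton p a b \<Longrightarrow>
       norm (x - xs) \<le> K * (norm (a - xs) * norm (b - xs))"
proof -
  define P where "P = tangent_lin p xs"
  have P: "P = secant_lin p xs xs" by (simp add: P_def tangent_lin_eq_secant_lin)
  have wds: "well_defined p xs" using eventually_nhds_x_imp_x[OF wd] .
  have proc: "procedure \<Phi> CARD('n) p" and Fxs: "proc_fun p xs = 0"
    using comp wds root by (auto simp: computes_def)
  obtain g where g: "g \<ge> 0" "\<forall>\<^sub>F r in at_right 0. \<forall>a\<in>ball xs r. \<forall>b\<in>ball xs r. \<forall>x\<in>ball xs r.
     norm (proc_fun p x - secant_lin p a b x) \<le> g * (norm (x - a) * norm (x - b))"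
    using proc_fun_secant_lin_estimate[OF lib proc wds] by blast
  obtain r0 where r0: "r0 > 0" "\<forall>r>0. r < r0 \<longrightarrow> (\<forall>a\<in>ball xs r. \<forall>b\<in>ball xs r. \<forall>x\<in>ball xs r.
     norm (proc_fun p x - secant_lin p a b x) \<le> g * (norm (x - a) * norm (x - b)))"
    using g(2) unfolding eventually_at_right_field by blast
  define s where "s = r0 / 2"
  have s: "s > 0" using r0 by (simp add: s_def)
  have est: "norm (proc_fun p x - secant_lin p a b x) \<le> g * (norm (x - a) * norm (x - b))"
    if "a \<in> ball xs s" "b \<in> ball xs s" "x \<in> ball xs s" for a b x
    using r0(2)[rule_format, of s a b x] r0(1) that by (simp add: s_def)
  have Pxs: "P xs = 0"
    using est[of xs xs xs] s Fxs by (simp add: P)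
  obtain c r1 where c: "c > 0" "r1 > 0" "\<And>y. y \<in> cball xs r1 \<Longrightarrow> c * norm (y - xs) \<le> norm (P y)"
    using coherently_oriented_lower_bound[OF co[folded P_def] U Pxs] by blast
  obtain r2 where r2: "r2 > 0" "\<And>x. dist x xs < r2 \<Longrightarrow> well_defined p x"
    using wd unfolding eventually_nhds_metric by blast
  obtain r3 where r3: "r3 > 0" "cball xs r3 \<subseteq> U" using U open_contains_cball by blast
  \<comment> \<open>This makes 16 g r at most c. It serves both 5 g r < c, the sphere condition with
    4 from the pair (a, b) and 1 from (xs, xs), and 8 g r \<le> c / 2, the absorption. Adding 1 to
    \<open>g\<close> avoids a zero denominator.\<close>
  define t where "t = c / (16 * (g + 1))"
  have t: "t > 0" using c(1) g(1) by (simp add: t_def)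
  \<comment> \<open>A selected zero is only known to lie within 3 r of \<open>xs\<close>. Hence the
    divisors 4 and 3: points at distance 3 r must still lie in the range of the estimate and of the
    lower bound.\<close>
  define r where "r = min (min (s / 4) (r1 / 3)) (min (min r2 r3) t)"
  have r: "r > 0" "r \<le> s / 4" "r \<le> r1 / 3" "r \<le> r2" "r \<le> r3" "r \<le> t"
    using s c(2) r2(1) r3(1) t by (auto simp: r_def min_le_iff_disj)
  have gr: "16 * (g * r) \<le> c"
  proof -
    have "16 * (g * r) \<le> 16 * ((g + 1) * r)" using r(1) by simp
    also have "\<dots> \<le> c" using r(6) g(1) by (simp add: t_def field_simps)
    finally show ?thesis .
  qed
  \<comment> \<open>Absorption leaves (c / 2) e \<le> g ea eb. Writing g + 1 makes \<open>K\<close>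
    positive, and \<open>R\<close> is cut down so that one step at least halves the error.\<close>
  define K where "K = 2 * (g + 1) / c"
  have K: "K > 0" using g c by (simp add: K_def)
  define R where "R = min r (1 / (2 * K))"
  have R: "R > 0" "R \<le> r" "K * R \<le> 1 / 2"
    using r K mult_left_mono[of R "1 / (2 * K)" K] by (auto simp: R_def)
  have ex: "\<exists>x\<in>cball xs r. secant_lin p a b x = 0" if ab: "a \<in> ball xs R" "b \<in> ball xs R" for a b
  proof (rule coherently_oriented_rouche[OF co[folded P_def] r(1) _ Pxs])
    show "cball xs r \<subseteq> U" using r3 r(5) by (auto simp: subset_iff)
    show "continuous_on (cball xs r) (secant_lin p a b)"
      using continuous_on_secant_lin continuous_on_subset by blast
    fix x assume x: "x \<in> sphere xs r"
    then have nx: "norm (x - xs) = r" by (simp add: dist_norm norm_minus_commute)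
    have na: "norm (a - xs) < r" "norm (b - xs) < r"
      using ab R by (auto simp: dist_norm norm_minus_commute)
    have le: "norm (x - a) \<le> 2 * r" "norm (x - b) \<le> 2 * r"
      using na nx norm_triangle_ineq4[of "x - xs" "a - xs"] norm_triangle_ineq4[of "x - xs" "b - xs"] by auto
    have inb: "a \<in> ball xs s" "b \<in> ball xs s" "x \<in> ball xs s" "xs \<in> ball xs s"
      using na nx r s by (auto simp: dist_norm norm_minus_commute)
    have "norm (secant_lin p a b x - P x) \<le>
        norm (proc_fun p x - secant_lin p a b x) + norm (proc_fun p x - P x)"
      by norm
    also have "\<dots> \<le> g * (norm (x - a) * norm (x - b)) + g * (norm (x - xs) * norm (x - xs))"
      unfolding P using inb by (intro add_mono est)
    also have "\<dots> \<le> g * ((2 * r) * (2 * r)) + g * (r * r)"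
      using le nx g(1) r(1) by (intro add_mono mult_left_mono mult_mono) auto
    also have "\<dots> = 5 * (g * r) * r" by simp
    also have "\<dots> < c * r" using gr r(1) c(1) mult_nonneg_nonneg[OF g(1), of r] by (intro mult_strict_right_mono) auto
    also have "\<dots> \<le> norm (P x)" using c(3)[of x] nx r x by simp
    finally show "norm (secant_lin p a b x - P x) < norm (P x)" .
  qed
  show thesis
  proof (rule that[OF R(1) K R(3)])
    fix a b assume ab: "a \<in> ball xs R" "b \<in> ball xs R"
    show "secant_newton_defined p a b"
      unfolding secant_newton_defined_def
      using ab ex[OF ab] r2(2) R r by (auto simp: dist_commute)
    fix x assume x: "x \<in> secant_newton p a b"
    then have x0: "secant_lin p a b x = 0"
      and min: "\<And>y. secant_lin p a b y = 0 \<Longrightarrow> norm (x - midpoint a b) \<le> norm (y - midpoint a b)"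
      unfolding secant_newton_def is_arg_min_linorder by auto
    obtain y where y: "y \<in> cball xs r" "secant_lin p a b y = 0" using ex[OF ab] by blast
    define ea eb e where "ea = norm (a - xs)" and "eb = norm (b - xs)" and "e = norm (x - xs)"
    have eab: "ea < r" "eb < r" "0 \<le> ea" "0 \<le> eb" "0 \<le> e"
      using ab R by (auto simp: ea_def eb_def e_def dist_norm norm_minus_commute)
    have "midpoint a b - xs = (1/2) *\<^sub>R ((a - xs) + (b - xs))"
      by (simp add: vec_eq_iff midpoint_def field_simps)
    then have mid: "norm (midpoint a b - xs) \<le> r"
      using norm_triangle_ineq[of "a - xs" "b - xs"] eab by (simp add: ea_def eb_def)
    \<comment> \<open>Minimality enters here: x is no farther from the midpoint than the zero y in
      the ball of radius r.\<close>
    have "e \<le> norm (x - midpoint a b) + norm (midpoint a b - xs)"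
      unfolding e_def by norm
    also have "\<dots> \<le> norm (y - midpoint a b) + norm (midpoint a b - xs)" using min[OF y(2)] by simp
    also have "\<dots> \<le> norm (y - xs) + 2 * norm (midpoint a b - xs)" by norm
    also have "\<dots> \<le> 3 * r" using mid y(1) by (simp add: dist_norm norm_minus_commute)
    finally have e3: "e \<le> 3 * r" .
    have inb: "a \<in> ball xs s" "b \<in> ball xs s" "x \<in> ball xs s" "xs \<in> ball xs s"
      using eab e3 r s by (auto simp: ea_def eb_def e_def dist_norm norm_minus_commute)
    have "norm (x - a) \<le> e + ea" "norm (x - b) \<le> e + eb"
      using norm_triangle_ineq4[of "x - xs" "a - xs"] norm_triangle_ineq4[of "x - xs" "b - xs"]
      by (auto simp: e_def ea_def eb_def)
    then have "g * (norm (x - a) * norm (x - b)) \<le> g * ((e + ea) * (e + eb))"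
      using g(1) eab by (intro mult_left_mono mult_mono) auto
    then have Fx: "norm (proc_fun p x) \<le> g * ((e + ea) * (e + eb))"
      using est[OF inb(1-3)] x0 by simp
    have "c * e \<le> norm (P x)" using c(3)[of x] e3 r by (simp add: e_def dist_norm norm_minus_commute)
    also have "\<dots> \<le> norm (proc_fun p x) + norm (proc_fun p x - P x)" by norm
    also have "\<dots> \<le> g * ((e + ea) * (e + eb)) + g * (e * e)"
      using Fx est[OF inb(4,4,3)] by (simp add: P e_def)
    \<comment> \<open>Apart from ea eb, every term of the expansion contains e. The accompanying
      factor is at most 3 r + r + r + 3 r = 8 r.\<close>
    also have "\<dots> = g * (ea * eb) + (g * (e + ea + eb + e)) * e" by (simp add: algebra_simps)
    also have "\<dots> \<le> g * (ea * eb) + (c / 2) * e"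
    proof -
      have "g * (e + ea + eb + e) \<le> g * (8 * r)" using e3 eab g(1) by (intro mult_left_mono) auto
      also have "\<dots> \<le> c / 2" using gr by simp
      finally show ?thesis using eab by (intro add_left_mono mult_right_mono)
    qed
    finally have "c * e \<le> 2 * g * (ea * eb)" by simp
    also have "\<dots> \<le> 2 * (g + 1) * (ea * eb)" using eab by (intro mult_right_mono) auto
    finally have "e \<le> K * (ea * eb)" using c(1) by (simp add: K_def field_simps)
    then show "norm (x - xs) \<le> K * (norm (a - xs) * norm (b - xs))"
      by (simp add: e_def ea_def eb_def)
  qed
qed

lemma tangent_newton_eq_secant_newton: "tangent_newton p a = secant_newton p a a"
  by (simp add: tangent_newton_def secant_newton_def tangent_lin_eq_secant_lin)

lemma tangent_newton_defined_iff: "tangent_newton_defined p a \<longleftrightarrow> secant_newton_defined p a a"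
  by (simp add: tangent_newton_defined_def secant_newton_defined_def tangent_lin_eq_secant_lin)

section \<open>Rates of convergence\<close>

lemma halving_tendsto:
  fixes x :: "nat \<Rightarrow> 'a::real_normed_vector"
  assumes "\<And>j. norm (x (Suc j) - l) \<le> norm (x j - l) / 2"
  shows "x \<longlonglongrightarrow> l"
proof -
  have le: "norm (x j - l) \<le> norm (x 0 - l) * (1/2) ^ j" for j
  proof (induction j)
    case (Suc j)
    then show ?case using assms[of j] by simp
  qed simp
  have "(\<lambda>j. norm (x 0 - l) * (1/2) ^ j) \<longlonglongrightarrow> 0"
    by (intro tendsto_mult_right_zero LIMSEQ_realpow_zero) auto
  then have "(\<lambda>j. x j - l) \<longlonglongrightarrow> 0"
    by (rule Lim_null_comparison[rotated]) (simp add: le)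
  then show ?thesis by (simp add: LIM_zero_iff)
qed

text \<open>After scaling by \<open>K\<close> the errors satisfy E (j+2) \<le> E (j+1) E j. The
  bounds q^(\<rho>^j) satisfy this with equality because \<rho>^2 = \<rho> + 1.\<close>

lemma golden_ratio_R_order:
  fixes x :: "nat \<Rightarrow> real^'n"
  assumes K: "K > 0" and half: "\<And>j. K * norm (x j - l) \<le> 1 / 2"
    and rec: "\<And>j. norm (x (Suc (Suc j)) - l) \<le> K * (norm (x (Suc j) - l) * norm (x j - l))"
  shows "converges_with_R_order ((1 + sqrt 5) / 2) x l"
proof -
  define \<rho> :: real where "\<rho> = (1 + sqrt 5) / 2"
  have \<rho>: "\<rho> > 1" "\<rho> * \<rho> = \<rho> + 1"
    using real_sqrt_pow2[of 5] real_less_rsqrt[of 1 5] by (auto simp: \<rho>_def field_simps power2_eq_square)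
  \<comment> \<open>The choice fits both initial values, which are at most 1 / 2: q \<ge> 1 / 2 and
    q^\<rho> = 1 / 2.\<close>
  define q :: real where "q = (1/2) powr (1 / \<rho>)"
  have "1 / \<rho> * ln (1/2) < 0" using \<rho> by (intro mult_pos_neg) auto
  then have q: "0 < q" "q < 1" by (simp_all add: q_def powr_def)
  define e where "e j = norm (x j - l)" for j
  have "K * e j \<le> q powr (\<rho> ^ j) \<and> K * e (Suc j) \<le> q powr (\<rho> ^ Suc j)" for j
  proof (induction j)
    case 0
    have "(1/2) powr 1 \<le> (1/2 :: real) powr (1 / \<rho>)"
      using \<rho> by (intro powr_mono') auto
    then have "1/2 \<le> q" by (simp add: q_def)
    moreover have "q powr \<rho> = 1/2" using \<rho> by (simp add: q_def powr_powr)
    ultimately show ?case using half[of 0] half[of 1] q by (simp add: e_def)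
  next
    case (Suc j)
    have "K * e (Suc (Suc j)) \<le> K * (K * (e (Suc j) * e j))"
      using rec[of j] K by (intro mult_left_mono) (auto simp: e_def)
    also have "\<dots> = (K * e (Suc j)) * (K * e j)" by simp
    also have "\<dots> \<le> q powr (\<rho> ^ Suc j) * q powr (\<rho> ^ j)"
      using Suc K by (intro mult_mono) (auto simp: e_def)
    also have "\<dots> = q powr (\<rho> ^ Suc j + \<rho> ^ j)" by (simp add: powr_add)
    also have "\<rho> ^ Suc j + \<rho> ^ j = \<rho> ^ Suc (Suc j)"
    proof -
      have "\<rho> ^ Suc (Suc j) = (\<rho> * \<rho>) * \<rho> ^ j" by simp
      then show ?thesis unfolding \<rho>(2) by (simp add: distrib_right)
    qed
    finally show ?case using Suc by simp
  qed
  then have bound: "norm (x j - l) \<le> (1 / K) * q powr (\<rho> ^ j)" for j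
    using K by (simp add: e_def field_simps)
  \<comment> \<open>Nothing relates the errors of the two starting points, so the halving begins
    only at index 1.\<close>
  have "(\<lambda>j. x (Suc j)) \<longlonglongrightarrow> l"
  proof (rule halving_tendsto)
    fix j
    have "norm (x (Suc (Suc j)) - l) \<le> (K * norm (x j - l)) * norm (x (Suc j) - l)"
      using rec[of j] by (simp add: mult_ac)
    also have "\<dots> \<le> 1/2 * norm (x (Suc j) - l)"
      using half by (intro mult_right_mono) auto
    finally show "norm (x (Suc (Suc j)) - l) \<le> norm (x (Suc j) - l) / 2" by simp
  qed
  then have "x \<longlonglongrightarrow> l" by (rule LIMSEQ_imp_Suc)
  with bound q K show ?thesis
    unfolding converges_with_R_order_def \<rho>_def[symmetric]
    by (intro conjI exI[of _ "1 / K"] exI[of _ q]) auto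
qed

theorem theorem3p9:
  fixes \<Phi> :: "elemental set" and p :: "instr list"
    and F :: "real^'n \<Rightarrow> real^'n" and xs :: "real^'n" and \<D> :: "(real^'n) set"
  assumes "elemental_library \<Phi>"
    and "computes \<Phi> p F"
    and "\<forall>\<^sub>F x in nhds xs. well_defined p x"
    and "open \<D>" and "xs \<in> \<D>"
    and "F xs = 0" and "\<forall>x\<in>\<D>. F x = 0 \<longrightarrow> x = xs"
    and "coherently_oriented_on \<D> (tangent_lin p xs)"
  shows "\<exists>R>0.
    (\<forall>x. x 0 \<in> ball xs R \<longrightarrow>
       (\<forall>m. (\<forall>j<m. x (Suc j) \<in> tangent_newton p (x j)) \<longrightarrow> tangent_newton_defined p (x m)) \<and>
       ((\<forall>j. x (Suc j) \<in> tangent_newton p (x j)) \<longrightarrow> converges_quadratically x xs)) \<and>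
    (\<forall>x. x 0 \<in> ball xs R \<and> x 1 \<in> ball xs R \<longrightarrow>
       (\<forall>m\<ge>1. (\<forall>j. 1 \<le> j \<and> j < m \<longrightarrow> x (j + 1) \<in> secant_newton p (x j) (x (j - 1))) \<longrightarrow>
          secant_newton_defined p (x m) (x (m - 1))) \<and>
       ((\<forall>j\<ge>1. x (j + 1) \<in> secant_newton p (x j) (x (j - 1))) \<longrightarrow>
          converges_with_R_order ((1 + sqrt 5) / 2) x xs))"
proof -
  obtain R K where R: "R > 0" and K: "K > 0" "K * R \<le> 1 / 2"
    and def: "\<And>a b. a \<in> ball xs R \<Longrightarrow> b \<in> ball xs R \<Longrightarrow> secant_newton_defined p a b"
    and step: "\<And>a b x. a \<in> ball xs R \<Longrightarrow> b \<in> ball xs R \<Longrightarrow> x \<in> secant_newton p a b \<Longrightarrow>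
       norm (x - xs) \<le> K * (norm (a - xs) * norm (b - xs))"
    using secant_newton_local_estimate[OF assms(1-6,8)] by blast
  have mem: "x \<in> ball xs R \<longleftrightarrow> norm (x - xs) < R" for x by (simp add: dist_norm norm_minus_commute)
  have half: "K * norm (a - xs) \<le> 1 / 2" if "a \<in> ball xs R" for a
  proof -
    have "K * norm (a - xs) \<le> K * R" using that K(1) unfolding mem by (intro mult_left_mono) auto
    with K(2) show ?thesis by linarith
  qed
  \<comment> \<open>The factor belonging to \<open>b\<close> is at most 1 / 2 after multiplication
    by \<open>K\<close>, so the error halves relative to \<open>a\<close>, the newer point, and the
    ball is invariant.\<close>
  have contr: "norm (x - xs) \<le> norm (a - xs) / 2" "x \<in> ball xs R"
    if "a \<in> ball xs R" "b \<in> ball xs R" "x \<in> secant_newton p a b" for a b x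
  proof -
    have "norm (x - xs) \<le> (K * norm (b - xs)) * norm (a - xs)" using step[OF that] by (simp add: mult_ac)
    also have "\<dots> \<le> 1 / 2 * norm (a - xs)" using half[OF that(2)] by (intro mult_right_mono) auto
    finally show "norm (x - xs) \<le> norm (a - xs) / 2" by simp
    then show "x \<in> ball xs R" using that(1) norm_ge_zero[of "a - xs"] unfolding mem by linarith
  qed
  \<comment> \<open>Only the first m steps are assumed, because definedness of the next step has to
    follow from a finite run.\<close>
  have tangent: "x m \<in> ball xs R"
    if "x 0 \<in> ball xs R" "\<And>j. j < m \<Longrightarrow> x (Suc j) \<in> tangent_newton p (x j)" for x :: "nat \<Rightarrow> real^'n" and m
    using that(2)
  proof (induction m)
    case (Suc m)
    then have "x m \<in> ball xs R" by simp
    then show ?case using contr(2)[of "x m" "x m"] Suc.prems[of m] by (simp add: tangent_newton_eq_secant_newton)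
  qed (rule that)
  \<comment> \<open>A secant step needs two predecessors, so the invariant carries a pair of
    consecutive iterates. The steps 1 to m produce the iterates up to index m + 1.\<close>
  have secant: "x m \<in> ball xs R \<and> x (Suc m) \<in> ball xs R"
    if "x 0 \<in> ball xs R" "x 1 \<in> ball xs R"
      "\<And>j. 1 \<le> j \<Longrightarrow> j \<le> m \<Longrightarrow> x (j + 1) \<in> secant_newton p (x j) (x (j - 1))"
    for x :: "nat \<Rightarrow> real^'n" and m
    using that(3)
  proof (induction m)
    case (Suc m)
    then have "x m \<in> ball xs R" "x (Suc m) \<in> ball xs R" by auto
    then show ?case using contr(2)[of "x (Suc m)" "x m"] Suc.prems[of "Suc m"] by simp
  qed (use that in simp)
  show ?thesis
  proof (intro exI[of _ R] conjI allI impI R)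
    fix x :: "nat \<Rightarrow> real^'n" and m
    assume "x 0 \<in> ball xs R" "\<forall>j<m. x (Suc j) \<in> tangent_newton p (x j)"
    then have "x m \<in> ball xs R" using tangent by blast
    then show "tangent_newton_defined p (x m)" by (simp add: tangent_newton_defined_iff def)
  next
    fix x :: "nat \<Rightarrow> real^'n"
    assume x: "x 0 \<in> ball xs R" "\<forall>j. x (Suc j) \<in> tangent_newton p (x j)"
    then have b: "x j \<in> ball xs R" for j using tangent by blast
    have n: "x (Suc j) \<in> secant_newton p (x j) (x j)" for j
      using x(2) by (simp add: tangent_newton_eq_secant_newton)
    have "x \<longlonglongrightarrow> xs" using contr(1)[OF b b n] by (rule halving_tendsto)
    moreover have "norm (x (Suc j) - xs) \<le> K * (norm (x j - xs))\<^sup>2" for j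
      using step[OF b b n] by (simp add: power2_eq_square)
    ultimately show "converges_quadratically x xs" unfolding converges_quadratically_def by blast
  next
    fix x :: "nat \<Rightarrow> real^'n" and m :: nat
    assume x: "x 0 \<in> ball xs R \<and> x 1 \<in> ball xs R" "1 \<le> m"
      "\<forall>j. 1 \<le> j \<and> j < m \<longrightarrow> x (j + 1) \<in> secant_newton p (x j) (x (j - 1))"
    \<comment> \<open>Step m uses the iterates m - 1 and m, which is the invariant at m - 1 and thus
      needs only the steps below m.\<close>
    then have "x (m - 1) \<in> ball xs R \<and> x (Suc (m - 1)) \<in> ball xs R"
      by (intro secant) auto
    then show "secant_newton_defined p (x m) (x (m - 1))" using x(2) by (simp add: def)
  next
    fix x :: "nat \<Rightarrow> real^'n"
    assume x: "x 0 \<in> ball xs R \<and> x 1 \<in> ball xs R"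
      "\<forall>j\<ge>1. x (j + 1) \<in> secant_newton p (x j) (x (j - 1))"
    then have b: "x j \<in> ball xs R" for j using secant[of x j] by auto
    have n: "x (Suc (Suc j)) \<in> secant_newton p (x (Suc j)) (x j)" for j
      using x(2)[rule_format, of "Suc j"] by simp
    show "converges_with_R_order ((1 + sqrt 5) / 2) x xs"
    proof (rule golden_ratio_R_order[OF K(1)])
      show "K * norm (x j - xs) \<le> 1 / 2" for j by (rule half[OF b])
      show "norm (x (Suc (Suc j)) - xs) \<le> K * (norm (x (Suc j) - xs) * norm (x j - xs))" for j
        by (rule step[OF b b n])
    qed
  qed
qed

end
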